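(* Let $p\ge1$, $m=2p$, let $\{\beta(k)\}_{k\ge0}$ be $p\times m$ matrices with $\beta(k)J\beta(k)^*=I_p$, put $C_k=2K^*\beta(k)^*\beta(k)K-j$, and consider the system $W_{k+1}(\lambda)-W_k(\lambda)=-\frac{i}{\lambda}jC_kW_k(\lambda)$, $W_0=I_m$, on the semiaxis $k\ge0$. Let $\varphi_\infty$ be the unique element of $\bigcap_{N\ge0}\mathcal N(N)$. Then $\lambda\mapsto\varphi_\infty(\bar\lambda)^*$ is the unique $p\times p$ matrix function $\varphi$ holomorphic in the open upper half-plane $\mathbb C_+$ such that for every $\lambda\in\mathbb C_+$ $$\sum_{k=0}^\infty[i\varphi(\lambda)^*\ \ I_p]\,q(\lambda)^kKW_k(\lambda)^*C_kW_k(\lambda)K^*\begin{bmatrix}-i\varphi(\lambda)\\ I_p\end{bmatrix}<\infty,$$ i.e. it is the unique Weyl function in $\mathbb C_+$ of the system on the semiaxis.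
   Context: $\mathbb C_-$ is the open lower half-plane; $q(\lambda)=|\lambda|^2(|\lambda|^2+1)^{-1}$; $j=\mathrm{diag}(I_p,-I_p)$, $J=\begin{bmatrix}0&I_p\\ I_p&0\end{bmatrix}$, $K=\frac1{\sqrt2}\begin{bmatrix}I_p&-I_p\\ I_p&I_p\end{bmatrix}$. For $N\ge0$ let $\mathcal W(N,\lambda)=\{\mathcal W_{ij}(N,\lambda)\}_{i,j=1}^2=KW_{N+1}(\bar\lambda)^*$ ($p\times p$ blocks), and $\mathcal N(N)$ the set of $p\times p$ matrix functions holomorphic in $\mathbb C_-$ of the form $i(\mathcal W_{21}(N,\cdot)R+\mathcal W_{22}(N,\cdot)Q)(\mathcal W_{11}(N,\cdot)R+\mathcal W_{12}(N,\cdot)Q)^{-1}$, with $R,Q$ $p\times p$ matrix functions meromorphic in $\mathbb C_-$, well defined at $-i$, $R^*R+Q^*Q>0$, $R^*R\le Q^*Q$. (It is known that $\bigcap_N\mathcal N(N)$ consists of exactly one function.) The series condition means convergence of the series of positive semidefinite matrices. *)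

theory Defs
  imports "HOL-Complex_Analysis.Complex_Analysis" "Jordan_Normal_Form.Matrix"
begin

definition adj :: "complex mat \<Rightarrow> complex mat" where
  "adj M = mat (dim_col M) (dim_row M) (\<lambda>(i,j). cnj (M $$ (j,i)))"

definition hstack :: "complex mat \<Rightarrow> complex mat \<Rightarrow> complex mat" where
  "hstack A B = mat (dim_row A) (dim_col A + dim_col B)
     (\<lambda>(i,j). if j < dim_col A then A $$ (i,j) else B $$ (i, j - dim_col A))"
definition vstack :: "complex mat \<Rightarrow> complex mat \<Rightarrow> complex mat" where
  "vstack A B = mat (dim_row A + dim_row B) (dim_col A)
     (\<lambda>(i,j). if i < dim_row A then A $$ (i,j) else B $$ (i - dim_row A, j))"

definition blk :: "nat \<Rightarrow> complex mat \<Rightarrow> nat \<Rightarrow> nat \<Rightarrow> complex mat" where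
  "blk p M r c = mat p p (\<lambda>(i,j). M $$ (r*p + i, c*p + j))"

definition qform :: "complex mat \<Rightarrow> (nat \<Rightarrow> complex) \<Rightarrow> complex" where
  "qform M v = (\<Sum>i<dim_row M. \<Sum>j<dim_col M. cnj (v i) * M $$ (i,j) * v j)"
definition psd :: "complex mat \<Rightarrow> bool" where
  "psd M \<longleftrightarrow> dim_row M = dim_col M \<and>
     (\<forall>v. Im (qform M v) = 0 \<and> Re (qform M v) \<ge> 0)"
definition posdef :: "complex mat \<Rightarrow> bool" where
  "posdef M \<longleftrightarrow> dim_row M = dim_col M \<and>
     (\<forall>v. (\<exists>i<dim_row M. v i \<noteq> 0) \<longrightarrow> Im (qform M v) = 0 \<and> Re (qform M v) > 0)"

definition jm :: "nat \<Rightarrow> complex mat" where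
  "jm p = four_block_mat (1\<^sub>m p) (0\<^sub>m p p) (0\<^sub>m p p) (- 1\<^sub>m p)"
definition Jm :: "nat \<Rightarrow> complex mat" where
  "Jm p = four_block_mat (0\<^sub>m p p) (1\<^sub>m p) (1\<^sub>m p) (0\<^sub>m p p)"
definition Km :: "nat \<Rightarrow> complex mat" where
  "Km p = complex_of_real (1 / sqrt 2) \<cdot>\<^sub>m four_block_mat (1\<^sub>m p) (- 1\<^sub>m p) (1\<^sub>m p) (1\<^sub>m p)"

definition qfun :: "complex \<Rightarrow> real" where
  "qfun z = (cmod z)^2 / ((cmod z)^2 + 1)"

definition lower_hp :: "complex set" where "lower_hp = {z. Im z < 0}"
definition upper_hp :: "complex set" where "upper_hp = {z. Im z > 0}"

definition Cmat :: "nat \<Rightarrow> (nat \<Rightarrow> complex mat) \<Rightarrow> nat \<Rightarrow> complex mat" where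
  "Cmat p \<beta> k = 2 \<cdot>\<^sub>m (adj (Km p) * adj (\<beta> k) * \<beta> k * Km p) - jm p"

fun Wsol :: "nat \<Rightarrow> (nat \<Rightarrow> complex mat) \<Rightarrow> nat \<Rightarrow> complex \<Rightarrow> complex mat" where
  "Wsol p \<beta> 0 z = 1\<^sub>m (2*p)"
| "Wsol p \<beta> (Suc k) z = Wsol p \<beta> k z + (- \<i> / z) \<cdot>\<^sub>m (jm p * Cmat p \<beta> k * Wsol p \<beta> k z)"

definition calW :: "nat \<Rightarrow> (nat \<Rightarrow> complex mat) \<Rightarrow> nat \<Rightarrow> complex \<Rightarrow> complex mat" where
  "calW p \<beta> N z = Km p * adj (Wsol p \<beta> (Suc N) (cnj z))"

definition mat_holomorphic_on :: "nat \<Rightarrow> (complex \<Rightarrow> complex mat) \<Rightarrow> complex set \<Rightarrow> bool" where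
  "mat_holomorphic_on p f S \<longleftrightarrow>
     (\<forall>z\<in>S. dim_row (f z) = p \<and> dim_col (f z) = p) \<and>
     (\<forall>a<p. \<forall>b<p. (\<lambda>z. f z $$ (a,b)) holomorphic_on S)"

definition mat_meromorphic_on :: "nat \<Rightarrow> (complex \<Rightarrow> complex mat) \<Rightarrow> complex set \<Rightarrow> bool" where
  "mat_meromorphic_on p f S \<longleftrightarrow>
     (\<forall>z. dim_row (f z) = p \<and> dim_col (f z) = p) \<and>
     (\<forall>a<p. \<forall>b<p. (\<lambda>z. f z $$ (a,b)) meromorphic_on S)"

definition mat_regular_at :: "nat \<Rightarrow> (complex \<Rightarrow> complex mat) \<Rightarrow> complex \<Rightarrow> bool" where
  "mat_regular_at p f z \<longleftrightarrow> (\<forall>a<p. \<forall>b<p. (\<lambda>w. f w $$ (a,b)) analytic_on {z})"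

definition NN :: "nat \<Rightarrow> (nat \<Rightarrow> complex mat) \<Rightarrow> nat \<Rightarrow> (complex \<Rightarrow> complex mat) set" where
  "NN p \<beta> N = {\<phi>. mat_holomorphic_on p \<phi> lower_hp \<and>
     (\<exists>R Q. mat_meromorphic_on p R lower_hp \<and> mat_meromorphic_on p Q lower_hp \<and>
        mat_regular_at p R (- \<i>) \<and> mat_regular_at p Q (- \<i>) \<and>
        (\<forall>z\<in>lower_hp. mat_regular_at p R z \<and> mat_regular_at p Q z \<longrightarrow>
           (let W = calW p \<beta> N z;
                D = blk p W 0 0 * R z + blk p W 0 1 * Q z;
                U = blk p W 1 0 * R z + blk p W 1 1 * Q z
            in posdef (adj (R z) * R z + adj (Q z) * Q z) \<and>
               psd (adj (Q z) * Q z - adj (R z) * R z) \<and>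
               invertible_mat D \<and>
               \<phi> z * D = \<i> \<cdot>\<^sub>m U)))}"

definition weyl_term :: "nat \<Rightarrow> (nat \<Rightarrow> complex mat) \<Rightarrow> (complex \<Rightarrow> complex mat) \<Rightarrow> complex \<Rightarrow> nat \<Rightarrow> complex mat" where
  "weyl_term p \<beta> \<phi> z k =
     hstack (\<i> \<cdot>\<^sub>m adj (\<phi> z)) (1\<^sub>m p) *
     (complex_of_real (qfun z ^ k) \<cdot>\<^sub>m
        (Km p * adj (Wsol p \<beta> k z) * Cmat p \<beta> k * Wsol p \<beta> k z * adj (Km p))) *
     vstack ((- \<i>) \<cdot>\<^sub>m \<phi> z) (1\<^sub>m p)"

definition weyl_cond :: "nat \<Rightarrow> (nat \<Rightarrow> complex mat) \<Rightarrow> (complex \<Rightarrow> complex mat) \<Rightarrow> bool" where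
  "weyl_cond p \<beta> \<phi> \<longleftrightarrow>
     (\<forall>z\<in>upper_hp. \<forall>a<p. \<forall>b<p. summable (\<lambda>k. weyl_term p \<beta> \<phi> z k $$ (a,b)))"

end

theory Submission
  imports Defs "Jordan_Normal_Form.Determinant"
begin

text \<open>
  Write \<open>j(y) = y\<^sup>* j y\<close>.  Since \<open>C\<^sub>k j C\<^sub>k = j\<close>, the system satisfies
  \<open>q\<^sup>n j(W\<^sub>n x) = j(x) - c \<Sum>\<^bsub>k<n\<^esub> q\<^sup>k (W\<^sub>k x)\<^sup>* C\<^sub>k (W\<^sub>k x)\<close> with \<open>c = 2 Im \<lambda> / (|\<lambda>|\<^sup>2 + 1) > 0\<close>,
  and moreover \<open>C\<^sub>k \<ge> 0\<close> and \<open>C\<^sub>k \<ge> -j\<close>.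

  Existence: membership in \<open>\<N>(N)\<close> says that the vectors \<open>W\<^bsub>N+1\<^esub> K\<^sup>* [-i\<phi>; I] v\<close> are orthogonal to a
  maximal \<open>j\<close>-nonpositive subspace, so \<open>j \<ge> 0\<close> on them and the partial sums are bounded by \<open>j(x)/c\<close>;
  at the singularities of the pair \<open>(R, Q)\<close> this follows by continuity.

  Uniqueness: if the series at \<open>x\<close> converges, then \<open>C\<^sub>k \<ge> -j\<close> forces \<open>j(x) \<ge> 0\<close>.  Two different Weyl
  functions would put a neutral vector \<open>K\<^sup>* [u; 0]\<close> into this nonnegative subspace that is not
  \<open>j\<close>-orthogonal to it.
\<close>

unbundle no vec_syntax
unbundle no inner_syntax
unbundle no fps_syntax

section \<open>Sesquilinear inner product and adjoints\<close>

definition ip :: "complex Matrix.vec \<Rightarrow> complex Matrix.vec \<Rightarrow> complex" where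
  "ip u v = (\<Sum>i<dim_vec v. cnj (u $ i) * v $ i)"

abbreviation nsq :: "complex Matrix.vec \<Rightarrow> real" where
  "nsq v \<equiv> Re (ip v v)"

lemma ip_cnj: "dim_vec u = dim_vec v \<Longrightarrow> cnj (ip u v) = ip v u"
  by (simp add: ip_def mult.commute)

lemma ip_add_left:
  "u \<in> carrier_vec n \<Longrightarrow> v \<in> carrier_vec n \<Longrightarrow> w \<in> carrier_vec n \<Longrightarrow> ip (u + v) w = ip u w + ip v w"
  by (simp add: ip_def sum.distrib ring_distribs)

lemma ip_add_right:
  "u \<in> carrier_vec n \<Longrightarrow> v \<in> carrier_vec n \<Longrightarrow> w \<in> carrier_vec n \<Longrightarrow> ip u (v + w) = ip u v + ip u w"
  by (simp add: ip_def sum.distrib ring_distribs)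

lemma ip_diff_left:
  "u \<in> carrier_vec n \<Longrightarrow> v \<in> carrier_vec n \<Longrightarrow> w \<in> carrier_vec n \<Longrightarrow> ip (u - v) w = ip u w - ip v w"
  by (simp add: ip_def sum_subtractf ring_distribs)

lemma ip_diff_right:
  "u \<in> carrier_vec n \<Longrightarrow> v \<in> carrier_vec n \<Longrightarrow> w \<in> carrier_vec n \<Longrightarrow> ip u (v - w) = ip u v - ip u w"
  by (simp add: ip_def sum_subtractf ring_distribs)

lemma ip_smult_left:
  "u \<in> carrier_vec n \<Longrightarrow> v \<in> carrier_vec n \<Longrightarrow> ip (c \<cdot>\<^sub>v u) v = cnj c * ip u v"
  by (simp add: ip_def sum_distrib_left mult.assoc)

lemma ip_smult_right:
  "u \<in> carrier_vec n \<Longrightarrow> v \<in> carrier_vec n \<Longrightarrow> ip u (c \<cdot>\<^sub>v v) = c * ip u v"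
  by (simp add: ip_def sum_distrib_left mult_ac)

lemmas ip_linear = ip_add_left ip_add_right ip_diff_left ip_diff_right ip_smult_left ip_smult_right

lemma ip_append:
  assumes "a \<in> carrier_vec n" "c \<in> carrier_vec n" "b \<in> carrier_vec m" "d \<in> carrier_vec m"
  shows "ip (a @\<^sub>v b) (c @\<^sub>v d) = ip a c + ip b d"
proof -
  let ?f = "\<lambda>i. cnj ((a @\<^sub>v b) $ i) * (c @\<^sub>v d) $ i"
  have "ip (a @\<^sub>v b) (c @\<^sub>v d) = sum ?f {0..<n + m}"
    using assms by (simp add: ip_def lessThan_atLeast0)
  also have "\<dots> = sum ?f {0..<n} + sum ?f {n..<n + m}"
    by (rule sum.atLeastLessThan_concat[symmetric]) auto
  also have "sum ?f {0..<n} = ip a c"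
    using assms by (auto simp: ip_def lessThan_atLeast0 intro!: sum.cong)
  also have "sum ?f {n..<n + m} = ip b d"
    unfolding ip_def using assms
    by (intro sum.reindex_bij_witness[of _ "\<lambda>i. i + n" "\<lambda>i. i - n"]) auto
  finally show ?thesis .
qed

lemma ip_self_real: "Im (ip v v) = 0"
  by (simp add: ip_def)

lemma ip_self: "ip v v = of_real (nsq v)"
  by (simp add: complex_eq_iff ip_self_real)

lemma nsq_eq_sum: "nsq v = (\<Sum>i<dim_vec v. (cmod (v $ i))\<^sup>2)"
  unfolding ip_def Re_sum by (intro sum.cong refl) (simp only: cmod_power2, simp add: power2_eq_square)

lemma nsq_nonneg: "0 \<le> nsq v"
  unfolding nsq_eq_sum by (intro sum_nonneg) simp

lemma nsq_eq_0_imp: "nsq v = 0 \<Longrightarrow> v = 0\<^sub>v (dim_vec v)"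
  unfolding nsq_eq_sum by (subst (asm) sum_nonneg_eq_0_iff) auto

text \<open>Expand \<open>0 \<le> nsq (u - v)\<close>. This square-root-free form of Cauchy-Schwarz
  suits the comparison of squared norms in the complement argument.\<close>

lemma two_Re_ip_le:
  assumes "u \<in> carrier_vec n" "v \<in> carrier_vec n"
  shows "2 * Re (ip u v) \<le> nsq u + nsq v"
proof -
  have "Re (ip v u) = Re (ip u v)"
    using assms ip_cnj[of u v] by (metis carrier_vecD complex_cnj(1) cnj.simps(1))
  moreover have "0 \<le> nsq (u - v)" by (rule nsq_nonneg)
  ultimately show ?thesis using assms by (simp add: ip_linear)
qed

lemma adj_carrier [simp]: "A \<in> carrier_mat n m \<Longrightarrow> adj A \<in> carrier_mat m n"
  by (auto simp: adj_def)

lemma adj_adj [simp]: "adj (adj A) = A"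
  by (rule eq_matI) (auto simp: adj_def)

lemma ip_adj:
  assumes "A \<in> carrier_mat n m" "u \<in> carrier_vec m" "v \<in> carrier_vec n"
  shows "ip (A *\<^sub>v u) v = ip u (adj A *\<^sub>v v)"
proof -
  have "ip (A *\<^sub>v u) v = (\<Sum>i<n. \<Sum>j<m. cnj (A $$ (i,j)) * cnj (u $ j) * v $ i)"
    using assms by (simp add: ip_def scalar_prod_def sum_distrib_right lessThan_atLeast0)
  also have "\<dots> = (\<Sum>j<m. \<Sum>i<n. cnj (A $$ (i,j)) * cnj (u $ j) * v $ i)"
    by (rule sum.swap)
  also have "\<dots> = ip u (adj A *\<^sub>v v)"
    using assms by (simp add: ip_def adj_def scalar_prod_def sum_distrib_left lessThan_atLeast0 mult_ac)
  finally show ?thesis .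
qed

lemma ip_adj':
  assumes "A \<in> carrier_mat n m" "u \<in> carrier_vec n" "v \<in> carrier_vec m"
  shows "ip u (A *\<^sub>v v) = ip (adj A *\<^sub>v u) v"
  using ip_adj[of "adj A" m n u v] assms by simp

section \<open>Complements of maximal semidefinite subspaces\<close>

lemma injective_imp_surjective:
  fixes A :: "complex mat"
  assumes A: "A \<in> carrier_mat n n" and y: "y \<in> carrier_vec n"
    and inj: "\<And>x. x \<in> carrier_vec n \<Longrightarrow> A *\<^sub>v x = 0\<^sub>v n \<Longrightarrow> x = 0\<^sub>v n"
  obtains x where "x \<in> carrier_vec n" "A *\<^sub>v x = y"
proof -
  have "Determinant.det A \<noteq> 0"
    using inj unfolding det_0_iff_vec_prod_zero[OF A] by blast
  then have "A \<in> Units (ring_mat TYPE(complex) n ())" by (rule det_non_zero_imp_unit[OF A])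
  then obtain B where B: "B \<in> carrier_mat n n" "A * B = 1\<^sub>m n"
    by (auto simp: Units_def ring_mat_def)
  have "A *\<^sub>v (B *\<^sub>v y) = (A * B) *\<^sub>v y"
    using A B(1) y by (rule assoc_mult_mat_vec[symmetric])
  with B y show ?thesis by (intro that[of "B *\<^sub>v y"]) auto
qed

text \<open>The orthogonal complement of a maximal subspace that is semidefinite for
  \<open>|y\<^sub>1|\<^sup>2 - |y\<^sub>2|\<^sup>2\<close> is semidefinite of the opposite sign.  Solving \<open>A x = y\<^sub>1\<close> gives
  \<open>|y\<^sub>1|\<^sup>2 = - \<langle>B x, y\<^sub>2\<rangle>\<close>, so no norm of an adjoint is needed.\<close>

lemma orthogonal_complement_semidefinite:
  assumes A: "A \<in> carrier_mat n n" and B: "B \<in> carrier_mat n n"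
    and y1: "y1 \<in> carrier_vec n" and y2: "y2 \<in> carrier_vec n"
    and le: "\<And>x. x \<in> carrier_vec n \<Longrightarrow> nsq (B *\<^sub>v x) \<le> nsq (A *\<^sub>v x)"
    and inj: "\<And>x. x \<in> carrier_vec n \<Longrightarrow> A *\<^sub>v x = 0\<^sub>v n \<Longrightarrow> x = 0\<^sub>v n"
    and orth: "\<And>x. x \<in> carrier_vec n \<Longrightarrow> ip (A *\<^sub>v x) y1 + ip (B *\<^sub>v x) y2 = 0"
  shows "nsq y1 \<le> nsq y2"
proof -
  obtain x where x: "x \<in> carrier_vec n" "A *\<^sub>v x = y1"
    using injective_imp_surjective[OF A y1 inj] by blast
  have "nsq y1 = Re (ip ((-1) \<cdot>\<^sub>v (B *\<^sub>v x)) y2)"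
    using orth[OF x(1)] x B y2 ip_smult_left[of "B *\<^sub>v x" n y2 "-1"]
    by (simp add: add_eq_0_iff2)
  moreover have "nsq ((-1) \<cdot>\<^sub>v (B *\<^sub>v x)) = nsq (B *\<^sub>v x)"
    using B x by (simp add: ip_linear[where n=n])
  moreover have "2 * Re (ip ((-1) \<cdot>\<^sub>v (B *\<^sub>v x)) y2) \<le> nsq ((-1) \<cdot>\<^sub>v (B *\<^sub>v x)) + nsq y2"
    using B x y2 by (intro two_Re_ip_le) auto
  ultimately show ?thesis using le[OF x(1)] x by simp
qed

section \<open>The matrices j, J and K acting on split vectors\<close>

lemma adj_mult:
  assumes "A \<in> carrier_mat n m" "B \<in> carrier_mat m l"
  shows "adj (A * B) = adj B * adj A"
  using assms by (intro eq_matI) (simp_all add: adj_def scalar_prod_def mult.commute)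

lemma split_vec:
  assumes "x \<in> carrier_vec (n + m)"
  obtains a b where "a \<in> carrier_vec n" "b \<in> carrier_vec m" "x = a @\<^sub>v b"
  by (rule that[OF vec_first_carrier vec_last_carrier vec_first_last_append[OF assms, symmetric]])

lemma jm_carrier [simp]: "jm p \<in> carrier_mat (p + p) (p + p)"
  by (simp add: jm_def)

lemma Jm_carrier [simp]: "Jm p \<in> carrier_mat (p + p) (p + p)"
  by (simp add: Jm_def)

lemma Km_carrier [simp]: "Km p \<in> carrier_mat (p + p) (p + p)"
  by (simp add: Km_def)

lemma dim_jm [simp]: "dim_row (jm p) = p + p" "dim_col (jm p) = p + p"
  and dim_Jm [simp]: "dim_row (Jm p) = p + p" "dim_col (Jm p) = p + p"
  and dim_Km [simp]: "dim_row (Km p) = p + p" "dim_col (Km p) = p + p"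
  by (simp_all add: jm_def Jm_def Km_def)

lemma dim_adj [simp]: "dim_row (adj A) = dim_col A" "dim_col (adj A) = dim_row A"
  by (simp_all add: adj_def)

text \<open>The length of the product is the row count whatever the vector is, so this simp rule
  settles most carrier goals without tracking the vector.\<close>

lemma mult_mat_vec_carrier_iff [simp]: "A *\<^sub>v v \<in> carrier_vec n \<longleftrightarrow> dim_row A = n"
  using carrier_vecD[of "A *\<^sub>v v" n] carrier_vecI[of "A *\<^sub>v v" n] by auto

lemma jm_append:
  assumes "a \<in> carrier_vec p" "b \<in> carrier_vec p"
  shows "jm p *\<^sub>v (a @\<^sub>v b) = a @\<^sub>v - b"
  unfolding jm_def using assms by (subst four_block_mat_mult_vec) auto

lemma Jm_append:
  assumes "a \<in> carrier_vec p" "b \<in> carrier_vec p"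
  shows "Jm p *\<^sub>v (a @\<^sub>v b) = b @\<^sub>v a"
  unfolding Jm_def using assms by (subst four_block_mat_mult_vec) auto

lemma smult_mat_vec:
  fixes A :: "complex mat"
  assumes "A \<in> carrier_mat n m" "v \<in> carrier_vec m"
  shows "(c \<cdot>\<^sub>m A) *\<^sub>v v = c \<cdot>\<^sub>v (A *\<^sub>v v)"
  using assms by (intro eq_vecI) (auto simp: scalar_prod_def sum_distrib_left mult.assoc)

lemma Km_append:
  assumes "a \<in> carrier_vec p" "b \<in> carrier_vec p"
  shows "Km p *\<^sub>v (a @\<^sub>v b) = complex_of_real (1 / sqrt 2) \<cdot>\<^sub>v ((a - b) @\<^sub>v (a + b))"
proof -
  have "four_block_mat (1\<^sub>m p) (- 1\<^sub>m p) (1\<^sub>m p) (1\<^sub>m p) *\<^sub>v (a @\<^sub>v b) = (a - b) @\<^sub>v (a + b)"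
    using assms by (subst four_block_mat_mult_vec) auto
  then show ?thesis
    unfolding Km_def using assms by (subst smult_mat_vec) auto
qed

lemma adj_Km:
  "adj (Km p) = complex_of_real (1 / sqrt 2) \<cdot>\<^sub>m four_block_mat (1\<^sub>m p) (1\<^sub>m p) (- 1\<^sub>m p) (1\<^sub>m p)"
  by (rule eq_matI) (auto simp: adj_def Km_def)

lemma adj_Km_append:
  assumes "a \<in> carrier_vec p" "b \<in> carrier_vec p"
  shows "adj (Km p) *\<^sub>v (a @\<^sub>v b) = complex_of_real (1 / sqrt 2) \<cdot>\<^sub>v ((a + b) @\<^sub>v (b - a))"
proof -
  have "four_block_mat (1\<^sub>m p) (1\<^sub>m p) (- 1\<^sub>m p) (1\<^sub>m p) *\<^sub>v (a @\<^sub>v b) = (a + b) @\<^sub>v (b - a)"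
    using assms by (subst four_block_mat_mult_vec) (auto simp: uminus_add_conv_diff)
  then show ?thesis
    unfolding adj_Km using assms by (subst smult_mat_vec) auto
qed

text \<open>The identity \<open>K j K^* = J\<close> in applied form, ready for chains of
  matrix-vector products. The two factors 1 / sqrt 2 give 1/2, which cancels the 2 in (a + b) + (b -
  a) = 2 b and (a + b) - (b - a) = 2 a.\<close>

lemma Km_jm_adj_Km:
  assumes "x \<in> carrier_vec (p + p)"
  shows "Km p *\<^sub>v (jm p *\<^sub>v (adj (Km p) *\<^sub>v x)) = Jm p *\<^sub>v x"
proof -
  obtain a b where ab: "a \<in> carrier_vec p" "b \<in> carrier_vec p" "x = a @\<^sub>v b"
    using assms by (rule split_vec)
  let ?s = "complex_of_real (1 / sqrt 2)"
  have "?s * ?s = 1 / 2" by (simp flip: of_real_mult)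
  then have s: "?s * (?s * c) = c / 2" for c
    by (simp add: mult.assoc[symmetric] del: of_real_divide)
  have sm: "A *\<^sub>v (?s \<cdot>\<^sub>v v) = ?s \<cdot>\<^sub>v (A *\<^sub>v v)" if "A \<in> carrier_mat (p+p) (p+p)" "v \<in> carrier_vec (p+p)" for A v
    using that by (rule mult_mat_vec)
  have "Km p *\<^sub>v (jm p *\<^sub>v (adj (Km p) *\<^sub>v x)) = ?s \<cdot>\<^sub>v (?s \<cdot>\<^sub>v (((a + b) - - (b - a)) @\<^sub>v ((a + b) + - (b - a))))"
    using ab by (simp add: adj_Km_append sm jm_append Km_append del: of_real_divide)
  also have "\<dots> = b @\<^sub>v a"
    using ab by (intro eq_vecI) (auto simp: s algebra_simps simp del: of_real_divide)
  also have "\<dots> = Jm p *\<^sub>v x" using ab by (simp add: Jm_append)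
  finally show ?thesis .
qed

section \<open>The indefinite form of j\<close>

definition jip :: "nat \<Rightarrow> complex Matrix.vec \<Rightarrow> complex Matrix.vec \<Rightarrow> complex" where
  "jip p u v = ip u (jm p *\<^sub>v v)"

abbreviation jform :: "nat \<Rightarrow> complex Matrix.vec \<Rightarrow> real" where
  "jform p x \<equiv> Re (jip p x x)"

lemma jm_jm:
  assumes "x \<in> carrier_vec (p + p)"
  shows "jm p *\<^sub>v (jm p *\<^sub>v x) = x"
proof -
  obtain a b where "a \<in> carrier_vec p" "b \<in> carrier_vec p" "x = a @\<^sub>v b"
    using assms by (rule split_vec)
  then show ?thesis by (simp add: jm_append)
qed

lemma jip_append:
  assumes "a \<in> carrier_vec p" "b \<in> carrier_vec p" "c \<in> carrier_vec p" "d \<in> carrier_vec p"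
  shows "jip p (a @\<^sub>v b) (c @\<^sub>v d) = ip a c - ip b d"
proof -
  have "- d = (- 1) \<cdot>\<^sub>v d" by (rule eq_vecI) auto
  then have "ip b (- d) = - ip b d"
    using assms ip_smult_right[of b p d "- 1"] by simp
  then show ?thesis
    using assms by (simp add: jip_def jm_append ip_append)
qed

lemma jip_cnj:
  assumes "u \<in> carrier_vec (p + p)" "v \<in> carrier_vec (p + p)"
  shows "cnj (jip p u v) = jip p v u"
proof -
  obtain a b where ab: "a \<in> carrier_vec p" "b \<in> carrier_vec p" "u = a @\<^sub>v b"
    using assms(1) by (rule split_vec)
  obtain c d where cd: "c \<in> carrier_vec p" "d \<in> carrier_vec p" "v = c @\<^sub>v d"
    using assms(2) by (rule split_vec)
  show ?thesis using ab cd by (simp add: jip_append ip_cnj)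
qed

lemma jip_self:
  assumes "x \<in> carrier_vec (p + p)"
  shows "jip p x x = of_real (jform p x)"
proof -
  have "jip p x x \<in> \<real>" using jip_cnj[OF assms assms] by (simp only: Reals_cnj_iff)
  then show ?thesis by simp
qed

lemma jip_linear:
  assumes "u \<in> carrier_vec (p + p)" "v \<in> carrier_vec (p + p)" "w \<in> carrier_vec (p + p)"
  shows "jip p (u + v) w = jip p u w + jip p v w"
    and "jip p (u - v) w = jip p u w - jip p v w"
    and "jip p u (v + w) = jip p u v + jip p u w"
    and "jip p u (v - w) = jip p u v - jip p u w"
    and "jip p (c \<cdot>\<^sub>v u) v = cnj c * jip p u v"
    and "jip p u (c \<cdot>\<^sub>v v) = c * jip p u v"
  using assms
  by (simp_all add: jip_def ip_linear[where n = "p + p"] mult_add_distrib_mat_vec[OF jm_carrier]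
      mult_minus_distrib_mat_vec[OF jm_carrier] mult_mat_vec[OF jm_carrier])

text \<open>This is \<open>K j K\<^sup>* = J\<close> on the level of forms.\<close>

lemma jform_adj_Km:
  assumes "a \<in> carrier_vec p" "b \<in> carrier_vec p"
  shows "jform p (adj (Km p) *\<^sub>v (a @\<^sub>v b)) = 2 * Re (ip a b)"
proof -
  let ?x = "adj (Km p) *\<^sub>v (a @\<^sub>v b)"
  have x: "?x \<in> carrier_vec (p + p)" using assms by (intro mult_mat_vec_carrier[of _ _ "p + p"]) auto
  have "jip p ?x ?x = ip (a @\<^sub>v b) (Jm p *\<^sub>v (a @\<^sub>v b))"
    unfolding jip_def
    using assms x by (subst ip_adj[where n = "p + p" and m = "p + p"]) (auto simp: Km_jm_adj_Km)
  also have "\<dots> = ip a b + ip b a" using assms by (simp add: Jm_append ip_append)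
  also have "ip b a = cnj (ip a b)" using assms by (simp add: ip_cnj)
  finally show ?thesis by simp
qed

section \<open>A single step: the projection behind C and the positivity of C\<close>

locale canonical_system =
  fixes p :: nat and \<beta> :: "nat \<Rightarrow> complex mat"
  assumes \<beta>_carrier: "\<And>k. \<beta> k \<in> carrier_mat p (p + p)"
    and \<beta>_J: "\<And>k. \<beta> k * Jm p * adj (\<beta> k) = 1\<^sub>m p"
begin

text \<open>Absorbing K gives \<open>C = 2 \<gamma>^* \<gamma> - j\<close> and the normalization
  \<open>\<gamma> j \<gamma>^* = I\<close>, so that a single step involves only the form of
  j.\<close>

definition \<gamma> :: "nat \<Rightarrow> complex mat" where "\<gamma> k = \<beta> k * Km p"

lemma dim_\<beta> [simp]: "dim_row (\<beta> k) = p" "dim_col (\<beta> k) = p + p"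
  using \<beta>_carrier[of k] by auto

lemma \<gamma>_carrier [simp]: "\<gamma> k \<in> carrier_mat p (p + p)"
  unfolding \<gamma>_def by (rule mult_carrier_mat[OF \<beta>_carrier Km_carrier])

lemma dim_\<gamma> [simp]: "dim_row (\<gamma> k) = p" "dim_col (\<gamma> k) = p + p"
  using \<gamma>_carrier[of k] by (auto simp del: \<gamma>_carrier)

text \<open>This is \<open>\<beta> J \<beta>^* = I\<close>, carried over by
  \<open>K j K^* = J\<close>.\<close>

lemma \<gamma>_j_adj:
  assumes g: "g \<in> carrier_vec p"
  shows "\<gamma> k *\<^sub>v (jm p *\<^sub>v (adj (\<gamma> k) *\<^sub>v g)) = g"
proof -
  have b: "adj (\<beta> k) \<in> carrier_mat (p + p) p" using \<beta>_carrier by simp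
  have "adj (\<gamma> k) *\<^sub>v g = adj (Km p) *\<^sub>v (adj (\<beta> k) *\<^sub>v g)"
    unfolding \<gamma>_def adj_mult[OF \<beta>_carrier Km_carrier]
    by (rule assoc_mult_mat_vec[OF adj_carrier[OF Km_carrier] b g])
  then have "\<gamma> k *\<^sub>v (jm p *\<^sub>v (adj (\<gamma> k) *\<^sub>v g))
      = \<beta> k *\<^sub>v (Km p *\<^sub>v (jm p *\<^sub>v (adj (Km p) *\<^sub>v (adj (\<beta> k) *\<^sub>v g))))"
    unfolding \<gamma>_def by (simp add: assoc_mult_mat_vec[OF \<beta>_carrier Km_carrier])
  also have "\<dots> = \<beta> k *\<^sub>v (Jm p *\<^sub>v (adj (\<beta> k) *\<^sub>v g))"
    by (simp add: Km_jm_adj_Km)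
  also have "\<dots> = (\<beta> k * Jm p * adj (\<beta> k)) *\<^sub>v g"
    by (simp add: assoc_mult_mat_vec[OF mult_carrier_mat[OF \<beta>_carrier Jm_carrier] b g]
        assoc_mult_mat_vec[OF \<beta>_carrier Jm_carrier])
  also have "\<dots> = g" using g by (simp add: \<beta>_J)
  finally show ?thesis .
qed

lemma Cmat_carrier [simp]: "Cmat p \<beta> k \<in> carrier_mat (p + p) (p + p)"
  unfolding Cmat_def by (intro carrier_matI) auto

lemma dim_Cmat [simp]: "dim_row (Cmat p \<beta> k) = p + p" "dim_col (Cmat p \<beta> k) = p + p"
  using Cmat_carrier[of k] by (auto simp del: Cmat_carrier)

lemma Cmat_mult_vec:
  assumes y: "y \<in> carrier_vec (p + p)"
  shows "Cmat p \<beta> k *\<^sub>v y = 2 \<cdot>\<^sub>v (adj (\<gamma> k) *\<^sub>v (\<gamma> k *\<^sub>v y)) - jm p *\<^sub>v y"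
proof -
  have b: "adj (\<beta> k) \<in> carrier_mat (p + p) p" using \<beta>_carrier by simp
  have K: "adj (Km p) \<in> carrier_mat (p + p) (p + p)" by simp
  have "adj (Km p) * adj (\<beta> k) * \<beta> k * Km p = adj (\<gamma> k) * \<gamma> k"
    unfolding \<gamma>_def adj_mult[OF \<beta>_carrier Km_carrier]
    by (rule assoc_mult_mat[OF mult_carrier_mat[OF K b] \<beta>_carrier Km_carrier])
  then have "Cmat p \<beta> k = 2 \<cdot>\<^sub>m (adj (\<gamma> k) * \<gamma> k) - jm p" by (simp add: Cmat_def)
  moreover have G: "adj (\<gamma> k) * \<gamma> k \<in> carrier_mat (p + p) (p + p)"
    by (rule mult_carrier_mat[of _ _ p]) auto
  ultimately have "Cmat p \<beta> k *\<^sub>v y = (2 \<cdot>\<^sub>m (adj (\<gamma> k) * \<gamma> k)) *\<^sub>v y - jm p *\<^sub>v y"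
    using y by (simp add: minus_mult_distrib_mat_vec[of _ "p + p" "p + p"])
  also have "(2 \<cdot>\<^sub>m (adj (\<gamma> k) * \<gamma> k)) *\<^sub>v y = 2 \<cdot>\<^sub>v ((adj (\<gamma> k) * \<gamma> k) *\<^sub>v y)"
    by (rule smult_mat_vec[OF G y])
  also have "(adj (\<gamma> k) * \<gamma> k) *\<^sub>v y = adj (\<gamma> k) *\<^sub>v (\<gamma> k *\<^sub>v y)"
    by (rule assoc_mult_mat_vec[OF adj_carrier[OF \<gamma>_carrier] \<gamma>_carrier y])
  finally show ?thesis .
qed

lemma ip_Cmat:
  assumes y: "y \<in> carrier_vec (p + p)"
  shows "ip y (Cmat p \<beta> k *\<^sub>v y) = 2 * ip (\<gamma> k *\<^sub>v y) (\<gamma> k *\<^sub>v y) - jip p y y"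
  using y by (simp add: Cmat_mult_vec jip_def ip_linear[where n = "p + p"] ip_adj[OF \<gamma>_carrier])

text \<open>The matrix \<open>P = j \<gamma>^* \<gamma>\<close> is idempotent because
  \<open>\<gamma> j \<gamma>^* = I\<close>. It is the j-orthogonal projection onto the range of
  \<open>j \<gamma>^*\<close>, on which the form of j is positive.\<close>

definition proj :: "nat \<Rightarrow> complex Matrix.vec \<Rightarrow> complex Matrix.vec" where
  "proj k y = jm p *\<^sub>v (adj (\<gamma> k) *\<^sub>v (\<gamma> k *\<^sub>v y))"

lemma proj_carrier [simp]: "proj k y \<in> carrier_vec (p + p)"
  by (simp add: proj_def)

lemma jip_proj:
  fixes k
  assumes y: "y \<in> carrier_vec (p + p)"
  defines "g \<equiv> \<gamma> k *\<^sub>v y"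
  shows "jip p y (proj k y) = ip g g"
    and "jip p (proj k y) y = ip g g"
    and "jip p (proj k y) (proj k y) = ip g g"
proof -
  have g: "g \<in> carrier_vec p" by (simp add: g_def)
  have jj: "jm p *\<^sub>v proj k y = adj (\<gamma> k) *\<^sub>v g"
    by (simp add: proj_def g_def jm_jm)
  show 1: "jip p y (proj k y) = ip g g"
    unfolding jip_def jj using ip_adj[OF \<gamma>_carrier y g] by (simp add: g_def)
  show "jip p (proj k y) y = ip g g"
    using jip_cnj[OF y proj_carrier[of k y]] ip_cnj[of g g] by (simp add: 1)
  have "\<gamma> k *\<^sub>v proj k y = g"
    using \<gamma>_j_adj[OF g] by (simp add: proj_def g_def)
  then show "jip p (proj k y) (proj k y) = ip g g"
    unfolding jip_def jj using ip_adj[OF \<gamma>_carrier[of k] proj_carrier[of k y] g] by simp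
qed

text \<open>The kernel of \<open>\<gamma>\<close> is the orthogonal complement of the range of
  \<open>\<gamma>^*\<close>, a p-dimensional subspace on which the form of j is positive;
  complements of such subspaces are nonpositive.\<close>

lemma ker_\<gamma>_nonpos:
  assumes u: "u \<in> carrier_vec (p + p)" and 0: "\<gamma> k *\<^sub>v u = 0\<^sub>v p"
  shows "jform p u \<le> 0"
proof -
  obtain a b where ab: "a \<in> carrier_vec p" "b \<in> carrier_vec p" "u = a @\<^sub>v b"
    using u by (rule split_vec)
  \<comment> \<open>The upper and lower halves of \<open>\<gamma>^*\<close>. The normalization reads
    |A x|^2 - |B x|^2 = |x|^2, so A is injective and dominates B.\<close>
  define A where "A = mat p p (\<lambda>(i,j). adj (\<gamma> k) $$ (i, j))"
  define B where "B = mat p p (\<lambda>(i,j). adj (\<gamma> k) $$ (p + i, j))"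
  have AB: "adj (\<gamma> k) *\<^sub>v x = A *\<^sub>v x @\<^sub>v B *\<^sub>v x" if "x \<in> carrier_vec p" for x
    using that by (intro eq_vecI) (auto simp: A_def B_def scalar_prod_def)
  have C: "A \<in> carrier_mat p p" "B \<in> carrier_mat p p" by (auto simp: A_def B_def)
  have iso: "nsq (A *\<^sub>v x) = nsq x + nsq (B *\<^sub>v x)" if x: "x \<in> carrier_vec p" for x
  proof -
    have "ip x x = jip p (adj (\<gamma> k) *\<^sub>v x) (adj (\<gamma> k) *\<^sub>v x)"
      unfolding jip_def using x
      by (subst ip_adj[of _ "p + p" p]) (auto simp: \<gamma>_j_adj)
    also have "\<dots> = ip (A *\<^sub>v x) (A *\<^sub>v x) - ip (B *\<^sub>v x) (B *\<^sub>v x)"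
      using x C by (simp add: AB jip_append)
    finally show ?thesis by simp
  qed
  have "nsq a \<le> nsq b"
  proof (rule orthogonal_complement_semidefinite[OF C ab(1,2)])
    fix x :: "complex Matrix.vec" assume x: "x \<in> carrier_vec p"
    show "nsq (B *\<^sub>v x) \<le> nsq (A *\<^sub>v x)" using iso[OF x] nsq_nonneg[of x] by simp
    have "ip (A *\<^sub>v x) a + ip (B *\<^sub>v x) b = ip (adj (\<gamma> k) *\<^sub>v x) u"
      using x ab C by (simp add: AB ip_append)
    also have "\<dots> = ip x (0\<^sub>v p)"
      using x u 0 by (subst ip_adj[of _ "p + p" p]) auto
    finally show "ip (A *\<^sub>v x) a + ip (B *\<^sub>v x) b = 0" by (simp add: ip_def)
    assume "A *\<^sub>v x = 0\<^sub>v p"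
    then have "nsq (A *\<^sub>v x) = 0" by (simp add: ip_def)
    then have "nsq x = 0" using iso[OF x] nsq_nonneg[of x] nsq_nonneg[of "B *\<^sub>v x"] by simp
    then show "x = 0\<^sub>v p" using nsq_eq_0_imp[of x] x by simp
  qed
  then show ?thesis using ab by (simp add: jip_append)
qed

text \<open>Taking the real part makes the form real-valued; by \<open>ip_Cmat_real\<close> nothing
  is lost.\<close>

definition cform :: "nat \<Rightarrow> complex Matrix.vec \<Rightarrow> real" where
  "cform k y = Re (ip y (Cmat p \<beta> k *\<^sub>v y))"

lemma cform_eq:
  assumes "y \<in> carrier_vec (p + p)"
  shows "cform k y = 2 * nsq (\<gamma> k *\<^sub>v y) - jform p y"
  using assms by (simp add: cform_def ip_Cmat)

lemma ip_Cmat_real: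
  assumes "y \<in> carrier_vec (p + p)"
  shows "ip y (Cmat p \<beta> k *\<^sub>v y) = of_real (cform k y)"
  using assms by (simp add: ip_Cmat cform_eq) (metis ip_self jip_self)

text \<open>Split y into P y and y - P y. They are j-orthogonal, the first contributes |\<gamma>
  y|^2 to the form of j, and the second lies in the kernel of \<open>\<gamma>\<close> and
  contributes at most 0. Hence the form of j is at most |\<gamma> y|^2, half of the positive term in
  \<open>cform_eq\<close>.\<close>

lemma cform_nonneg:
  assumes y: "y \<in> carrier_vec (p + p)"
  shows "0 \<le> cform k y"
proof -
  have "\<gamma> k *\<^sub>v (y - proj k y) = 0\<^sub>v p"
    using y \<gamma>_j_adj[of "\<gamma> k *\<^sub>v y" k]
    by (simp add: mult_minus_distrib_mat_vec[OF \<gamma>_carrier] proj_def)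
  then have "jform p (y - proj k y) \<le> 0"
    using y by (intro ker_\<gamma>_nonpos) auto
  moreover have "jform p (y - proj k y) = jform p y - nsq (\<gamma> k *\<^sub>v y)"
    using y by (simp add: jip_linear jip_proj)
  ultimately show ?thesis using nsq_nonneg[of "\<gamma> k *\<^sub>v y"] by (simp add: cform_eq[OF y])
qed

text \<open>Because \<open>C + j = 2 \<gamma>^* \<gamma>\<close> is positive semidefinite.\<close>

lemma neg_jform_le_cform:
  assumes y: "y \<in> carrier_vec (p + p)"
  shows "- jform p y \<le> cform k y"
  using nsq_nonneg[of "\<gamma> k *\<^sub>v y"] by (simp add: cform_eq[OF y])

section \<open>Evolution along the system and the weighted energy identity\<close>

lemma Wsol_carrier [simp]: "Wsol p \<beta> k z \<in> carrier_mat (p + p) (p + p)"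
  by (induction k) (auto simp: mult_2[of p])

lemma dim_Wsol [simp]: "dim_row (Wsol p \<beta> k z) = p + p" "dim_col (Wsol p \<beta> k z) = p + p"
  using Wsol_carrier[of k z] by (auto simp del: Wsol_carrier)

text \<open>Since j is an involution, \<open>j C = 2 P - I\<close> is the reflection belonging to
  the projection P.\<close>

lemma Wsol_Suc_mult_vec:
  fixes k z
  assumes x: "x \<in> carrier_vec (p + p)"
  defines "y \<equiv> Wsol p \<beta> k z *\<^sub>v x"
  shows "Wsol p \<beta> (Suc k) z *\<^sub>v x = y - (\<i> / z) \<cdot>\<^sub>v (2 \<cdot>\<^sub>v proj k y - y)"
proof -
  let ?W = "Wsol p \<beta> k z"
  have y: "y \<in> carrier_vec (p + p)" by (simp add: y_def)
  have jC: "jm p * Cmat p \<beta> k \<in> carrier_mat (p + p) (p + p)" by (rule mult_carrier_mat) auto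
  then have jCW: "jm p * Cmat p \<beta> k * ?W \<in> carrier_mat (p + p) (p + p)" by (rule mult_carrier_mat) auto
  have "(jm p * Cmat p \<beta> k * ?W) *\<^sub>v x = jm p *\<^sub>v (Cmat p \<beta> k *\<^sub>v y)"
    using x y by (simp add: assoc_mult_mat_vec[OF jC Wsol_carrier x] y_def
        assoc_mult_mat_vec[OF jm_carrier Cmat_carrier])
  also have "\<dots> = 2 \<cdot>\<^sub>v proj k y - y"
    using y by (simp add: Cmat_mult_vec proj_def jm_jm mult_minus_distrib_mat_vec[OF jm_carrier]
        mult_mat_vec[OF jm_carrier])
  finally have "(jm p * Cmat p \<beta> k * ?W) *\<^sub>v x = 2 \<cdot>\<^sub>v proj k y - y" .
  then have "Wsol p \<beta> (Suc k) z *\<^sub>v x = y + (- \<i> / z) \<cdot>\<^sub>v (2 \<cdot>\<^sub>v proj k y - y)"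
    using x jCW by (simp add: add_mult_distrib_mat_vec[of _ "p + p" "p + p"] smult_mat_vec[of _ "p + p" "p + p"] y_def)
  also have "\<dots> = y - (\<i> / z) \<cdot>\<^sub>v (2 \<cdot>\<^sub>v proj k y - y)"
    using y by (intro eq_vecI) auto
  finally show ?thesis .
qed

text \<open>The k-th summand of the Weyl series as a quadratic form, with the outer factor K^*
  already applied to the argument.\<close>

definition hform :: "complex \<Rightarrow> nat \<Rightarrow> complex Matrix.vec \<Rightarrow> real" where
  "hform z k x = qfun z ^ k * cform k (Wsol p \<beta> k z *\<^sub>v x)"

lemma qfun_nonneg: "0 \<le> qfun z"
  by (simp add: qfun_def)

lemma hform_nonneg: "0 \<le> hform z k x"
  by (simp add: hform_def cform_nonneg qfun_nonneg)

text \<open>Write the step as y - a w with a = i / z and w = 2 P y - y. The reflection preserves the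
  form of j, so w contributes |a|^2 times the form of y, while the pairing of y with w is exactly
  the form of C. Moreover a + cnj a = 2 Im z / |z|^2.\<close>

lemma jform_step:
  assumes x: "x \<in> carrier_vec (p + p)" and z: "z \<noteq> 0"
  shows "qfun z * jform p (Wsol p \<beta> (Suc k) z *\<^sub>v x) =
    jform p (Wsol p \<beta> k z *\<^sub>v x) - 2 * Im z / ((cmod z)\<^sup>2 + 1) * cform k (Wsol p \<beta> k z *\<^sub>v x)"
proof -
  define y where "y = Wsol p \<beta> k z *\<^sub>v x"
  define s where "s = nsq (\<gamma> k *\<^sub>v y)"
  define t where "t = jform p y"
  define a where "a = \<i> / z"
  let ?w = "2 \<cdot>\<^sub>v proj k y - y"
  have y: "y \<in> carrier_vec (p + p)" by (simp add: y_def)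
  have P: "jip p y (proj k y) = of_real s" "jip p (proj k y) y = of_real s"
      "jip p (proj k y) (proj k y) = of_real s" "jip p y y = of_real t"
    using jip_proj[OF y, of k] ip_self[of "\<gamma> k *\<^sub>v y"] jip_self[OF y] by (simp_all add: s_def t_def)
  have w: "?w \<in> carrier_vec (p + p)" using y by simp
  have "jip p y ?w = of_real (2 * s - t)" "jip p ?w y = of_real (2 * s - t)" "jip p ?w ?w = of_real t"
    using y by (simp_all add: jip_linear P)
  then have "jip p (y - a \<cdot>\<^sub>v ?w) (y - a \<cdot>\<^sub>v ?w)
      = of_real t - (a + cnj a) * of_real (2 * s - t) + (a * cnj a) * of_real t"
    using y w by (simp add: jip_linear P algebra_simps)
  also have "a + cnj a = of_real (2 * Im z / (cmod z)\<^sup>2)"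
    unfolding complex_add_cnj by (simp add: a_def Re_divide cmod_power2)
  also have "a * cnj a = of_real (1 / (cmod z)\<^sup>2)"
    by (simp add: a_def norm_divide power_divide flip: complex_norm_square)
  finally have "jform p (y - a \<cdot>\<^sub>v ?w)
      = Re (of_real (t - 2 * Im z / (cmod z)\<^sup>2 * (2 * s - t) + 1 / (cmod z)\<^sup>2 * t))"
    by (simp only: of_real_add of_real_diff of_real_mult)
  then have "jform p (y - a \<cdot>\<^sub>v ?w) = t - 2 * Im z / (cmod z)\<^sup>2 * (2 * s - t) + 1 / (cmod z)\<^sup>2 * t"
    by (simp only: Re_complex_of_real)
  moreover have "Wsol p \<beta> (Suc k) z *\<^sub>v x = y - a \<cdot>\<^sub>v ?w"
    unfolding y_def a_def by (rule Wsol_Suc_mult_vec[OF x])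
  moreover have "cform k y = 2 * s - t" by (simp add: cform_eq[OF y] s_def t_def)
  ultimately have J: "qfun z * jform p (Wsol p \<beta> (Suc k) z *\<^sub>v x)
      = qfun z * (t - 2 * Im z / (cmod z)\<^sup>2 * cform k y + 1 / (cmod z)\<^sup>2 * t)"
    by simp
  \<comment> \<open>Here N stands for |z|^2, so the weight q is N / (N + 1): it turns the
    coefficient 1 + 1/N of t into 1 and the denominator N of the middle term into N + 1.\<close>
  have "N / (N + 1) * (t - 2 * m / N * c + 1 / N * t) = t - 2 * m / (N + 1) * c"
    if "N > 0" for N m c :: real
    using that by (simp add: divide_simps) (simp add: algebra_simps)
  from this[of "(cmod z)\<^sup>2" "Im z" "cform k y"] show ?thesis
    unfolding J unfolding qfun_def y_def[symmetric] t_def[symmetric] using z by simp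
qed

lemma jform_telescope:
  assumes x: "x \<in> carrier_vec (p + p)" and z: "z \<noteq> 0"
  shows "qfun z ^ n * jform p (Wsol p \<beta> n z *\<^sub>v x) =
    jform p x - 2 * Im z / ((cmod z)\<^sup>2 + 1) * (\<Sum>k<n. hform z k x)"
proof (induction n)
  case 0
  then show ?case using x by (simp add: mult_2[of p])
next
  case (Suc n)
  have "qfun z ^ Suc n * jform p (Wsol p \<beta> (Suc n) z *\<^sub>v x)
      = qfun z ^ n * (qfun z * jform p (Wsol p \<beta> (Suc n) z *\<^sub>v x))"
    by (simp only: power_Suc2 mult.assoc)
  also have "\<dots> = qfun z ^ n * jform p (Wsol p \<beta> n z *\<^sub>v x)
      - 2 * Im z / ((cmod z)\<^sup>2 + 1) * hform z n x"
    unfolding jform_step[OF x z] hform_def by (simp add: algebra_simps)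
  also have "\<dots> = jform p x - 2 * Im z / ((cmod z)\<^sup>2 + 1) * (\<Sum>k<Suc n. hform z k x)"
    unfolding Suc.IH sum.lessThan_Suc by (simp only: distrib_left diff_diff_eq)
  finally show ?case .
qed

text \<open>By the telescoped identity, \<open>jform p x\<close> is the weighted form of the n-th
  iterate plus a nonnegative multiple of a partial sum. As C dominates -j, the former is at least
  minus the n-th summand, and the summands of a convergent series tend to 0.\<close>

lemma jform_nonneg_if_summable:
  assumes x: "x \<in> carrier_vec (p + p)" and z: "Im z > 0" and sum: "summable (\<lambda>k. hform z k x)"
  shows "0 \<le> jform p x"
proof (rule LIMSEQ_le_const)
  have z0: "z \<noteq> 0" using z by auto
  show "(\<lambda>n. hform z n x + jform p x) \<longlonglongrightarrow> jform p x"
    using tendsto_add[OF summable_LIMSEQ_zero[OF sum] tendsto_const[of "jform p x"]] by simp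
  have "0 \<le> hform z n x + jform p x" for n
  proof -
    have "qfun z ^ n * (- jform p (Wsol p \<beta> n z *\<^sub>v x)) \<le> hform z n x"
      unfolding hform_def by (intro mult_left_mono neg_jform_le_cform) (auto simp: qfun_nonneg)
    moreover have "0 \<le> 2 * Im z / ((cmod z)\<^sup>2 + 1) * (\<Sum>k<n. hform z k x)"
      using z by (intro mult_nonneg_nonneg sum_nonneg divide_nonneg_nonneg) (auto simp: hform_nonneg)
    ultimately show ?thesis using jform_telescope[OF x z0, of n] by linarith
  qed
  then show "\<exists>N. \<forall>n\<ge>N. 0 \<le> hform z n x + jform p x" by blast
qed

text \<open>The telescoped identity bounds the partial sums by \<open>jform p x\<close> divided by
  the positive constant \<open>?c\<close>. The form is controlled only at indices
  \<open>Suc n\<close>, as the class with index N speaks of the solution at N + 1; these match the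
  sums over k \<le> n.\<close>

lemma summable_if_jform_nonneg:
  assumes x: "x \<in> carrier_vec (p + p)" and z: "Im z > 0"
    and J: "\<And>n. 0 \<le> jform p (Wsol p \<beta> (Suc n) z *\<^sub>v x)"
  shows "summable (\<lambda>k. hform z k x)"
proof (rule bounded_imp_summable)
  let ?c = "2 * Im z / ((cmod z)\<^sup>2 + 1)"
  have z0: "z \<noteq> 0" using z by auto
  have c: "?c > 0" using z by (intro divide_pos_pos) (auto intro: add_nonneg_pos)
  show "0 \<le> hform z n x" for n by (rule hform_nonneg)
  show "(\<Sum>k\<le>n. hform z k x) \<le> jform p x / ?c" for n
  proof -
    have "0 \<le> qfun z ^ Suc n * jform p (Wsol p \<beta> (Suc n) z *\<^sub>v x)"
      using J by (intro mult_nonneg_nonneg) (auto simp: qfun_nonneg simp del: Wsol.simps)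
    then have "?c * (\<Sum>k<Suc n. hform z k x) \<le> jform p x"
      unfolding jform_telescope[OF x z0] by linarith
    then show ?thesis
      unfolding pos_le_divide_eq[OF c] lessThan_Suc_atMost by (simp only: mult.commute)
  qed
qed

end

section \<open>From matrix entries to quadratic forms by polarization\<close>

lemma ip_mult_mat_vec_polarization:
  assumes M: "M \<in> carrier_mat n n" and x: "x \<in> carrier_vec n" and y: "y \<in> carrier_vec n"
  defines "f \<equiv> \<lambda>v. ip v (M *\<^sub>v v)"
  shows "ip x (M *\<^sub>v y) =
    (f (x + y) - f (x - y) - \<i> * (f (x + \<i> \<cdot>\<^sub>v y) - f (x - \<i> \<cdot>\<^sub>v y))) / 4"
proof -
  have d: "dim_row M = n" using M by auto
  show ?thesis
    using x y d unfolding f_def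
    by (simp add: ip_linear[where n = n] mult_add_distrib_mat_vec[OF M] mult_minus_distrib_mat_vec[OF M]
        mult_mat_vec[OF M] algebra_simps)
qed

lemma index_eq_ip:
  assumes "M \<in> carrier_mat n n" "a < n" "b < n"
  shows "M $$ (a, b) = ip (unit_vec n a) (M *\<^sub>v unit_vec n b)"
proof -
  have "ip (unit_vec n a) w = w $ a" if "w \<in> carrier_vec n" for w
    using assms that by (simp add: ip_def unit_vec_def if_distrib[of cnj] mult_delta_left cong: if_cong)
  from this[of "M *\<^sub>v unit_vec n b"] show ?thesis
    using assms by simp
qed

text \<open>A quadratic form is a finite combination of entries; conversely polarization at unit
  vectors writes each entry through four values of the form.\<close>

lemma summable_entries_iff_ip:
  assumes T: "\<And>k::nat. T k \<in> carrier_mat n n"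
  shows "(\<forall>a<n. \<forall>b<n. summable (\<lambda>k. T k $$ (a, b))) \<longleftrightarrow>
    (\<forall>v\<in>carrier_vec n. summable (\<lambda>k. ip v (T k *\<^sub>v v)))"
proof (intro iffI ballI allI impI)
  fix v :: "complex Matrix.vec"
  assume S: "\<forall>a<n. \<forall>b<n. summable (\<lambda>k. T k $$ (a, b))" and v: "v \<in> carrier_vec n"
  have "dim_row (T k) = n" "dim_col (T k) = n" for k using T[of k] by auto
  then have "ip v (T k *\<^sub>v v) = (\<Sum>a<n. cnj (v $ a) * (\<Sum>b<n. T k $$ (a, b) * v $ b))" for k
    using v by (auto simp: ip_def scalar_prod_def lessThan_atLeast0 intro!: sum.cong)
  then show "summable (\<lambda>k. ip v (T k *\<^sub>v v))"
    using S by (auto intro!: summable_sum summable_mult summable_mult2)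
next
  fix a b assume S: "\<forall>v\<in>carrier_vec n. summable (\<lambda>k. ip v (T k *\<^sub>v v))" and ab: "a < n" "b < n"
  let ?x = "unit_vec n a :: complex Matrix.vec" and ?y = "unit_vec n b :: complex Matrix.vec"
  show "summable (\<lambda>k. T k $$ (a, b))"
    unfolding index_eq_ip[OF T ab] ip_mult_mat_vec_polarization[OF T unit_vec_carrier unit_vec_carrier]
    using S by (intro summable_divide summable_diff summable_mult) auto
qed

section \<open>Weyl vectors and uniqueness\<close>

context canonical_system
begin

definition weyl_vec :: "complex mat \<Rightarrow> complex Matrix.vec \<Rightarrow> complex Matrix.vec" where
  "weyl_vec \<Phi> v = adj (Km p) *\<^sub>v ((- \<i>) \<cdot>\<^sub>v (\<Phi> *\<^sub>v v) @\<^sub>v v)"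

lemma weyl_vec_carrier [simp]: "weyl_vec \<Phi> v \<in> carrier_vec (p + p)"
  by (simp add: weyl_vec_def)

lemma vstack_one_mult_vec:
  assumes "\<Phi> \<in> carrier_mat p p" "v \<in> carrier_vec p"
  shows "vstack (c \<cdot>\<^sub>m \<Phi>) (1\<^sub>m p) *\<^sub>v v = c \<cdot>\<^sub>v (\<Phi> *\<^sub>v v) @\<^sub>v v"
proof (rule eq_vecI)
  fix i assume i: "i < dim_vec (c \<cdot>\<^sub>v (\<Phi> *\<^sub>v v) @\<^sub>v v)"
  show "(vstack (c \<cdot>\<^sub>m \<Phi>) (1\<^sub>m p) *\<^sub>v v) $ i = (c \<cdot>\<^sub>v (\<Phi> *\<^sub>v v) @\<^sub>v v) $ i"
  proof (cases "i < p")
    case True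
    then show ?thesis
      using assms i by (auto simp: vstack_def scalar_prod_def sum_distrib_left mult.assoc)
  next
    case False
    then have "(vstack (c \<cdot>\<^sub>m \<Phi>) (1\<^sub>m p) *\<^sub>v v) $ i = (\<Sum>j<p. if j = i - p then v $ j else 0)"
      using assms i by (auto simp: vstack_def scalar_prod_def mult_delta_left)
    then show ?thesis using False assms i by auto
  qed
qed (use assms in \<open>auto simp: vstack_def\<close>)

lemma hstack_eq_adj_vstack:
  assumes "\<Phi> \<in> carrier_mat p p"
  shows "hstack (\<i> \<cdot>\<^sub>m adj \<Phi>) (1\<^sub>m p) = adj (vstack ((- \<i>) \<cdot>\<^sub>m \<Phi>) (1\<^sub>m p))"
  using assms by (intro eq_matI) (auto simp: hstack_def vstack_def adj_def)

lemma weyl_term_carrier: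
  assumes "\<phi> z \<in> carrier_mat p p"
  shows "weyl_term p \<beta> \<phi> z k \<in> carrier_mat p p"
  using assms by (intro carrier_matI) (auto simp: weyl_term_def hstack_def vstack_def)

text \<open>The left factors of the term are the adjoints of the right ones in reverse order. Moving
  them across the inner product leaves the form of C at \<open>W *\<^sub>v x\<close>, scaled by the
  power of q.\<close>

lemma ip_weyl_term:
  assumes \<Phi>: "\<phi> z \<in> carrier_mat p p" and v: "v \<in> carrier_vec p"
  shows "ip v (weyl_term p \<beta> \<phi> z k *\<^sub>v v) = of_real (hform z k (weyl_vec (\<phi> z) v))"
proof -
  define Y where "Y = vstack ((- \<i>) \<cdot>\<^sub>m \<phi> z) (1\<^sub>m p)"
  define W where "W = Wsol p \<beta> k z"
  define c where "c = complex_of_real (qfun z ^ k)"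
  have Y: "Y \<in> carrier_mat (p + p) p" using \<Phi> by (auto simp: Y_def vstack_def)
  have W: "W \<in> carrier_mat (p + p) (p + p)" by (simp add: W_def)
  have aK: "adj (Km p) \<in> carrier_mat (p + p) (p + p)" by simp
  have aW: "adj W \<in> carrier_mat (p + p) (p + p)" using W by simp
  note M1 = mult_carrier_mat[OF Km_carrier aW]
  note M2 = mult_carrier_mat[OF M1 Cmat_carrier[of k]]
  note M3 = mult_carrier_mat[OF M2 W]
  note M4 = mult_carrier_mat[OF M3 aK]
  let ?M = "Km p * adj W * Cmat p \<beta> k * W * adj (Km p)"
  have T: "c \<cdot>\<^sub>m ?M \<in> carrier_mat (p + p) (p + p)" using M4 by simp
  have Yv: "Y *\<^sub>v v \<in> carrier_vec (p + p)" using Y by simp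
  define x where "x = adj (Km p) *\<^sub>v (Y *\<^sub>v v)"
  have x: "x \<in> carrier_vec (p + p)" by (simp add: x_def)
  have Wx: "W *\<^sub>v x \<in> carrier_vec (p + p)" using W by simp
  have CWx: "Cmat p \<beta> k *\<^sub>v (W *\<^sub>v x) \<in> carrier_vec (p + p)" by simp
  have "weyl_term p \<beta> \<phi> z k = adj Y * (c \<cdot>\<^sub>m ?M) * Y"
    unfolding weyl_term_def hstack_eq_adj_vstack[OF \<Phi>] Y_def W_def c_def ..
  then have "weyl_term p \<beta> \<phi> z k *\<^sub>v v = adj Y *\<^sub>v ((c \<cdot>\<^sub>m ?M) *\<^sub>v (Y *\<^sub>v v))"
    by (simp add: assoc_mult_mat_vec[OF mult_carrier_mat[OF adj_carrier[OF Y] T] Y v]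
        assoc_mult_mat_vec[OF adj_carrier[OF Y] T Yv])
  then have "ip v (weyl_term p \<beta> \<phi> z k *\<^sub>v v) = ip (Y *\<^sub>v v) ((c \<cdot>\<^sub>m ?M) *\<^sub>v (Y *\<^sub>v v))"
    using ip_adj[OF Y v, of "(c \<cdot>\<^sub>m ?M) *\<^sub>v (Y *\<^sub>v v)"] by simp
  also have "(c \<cdot>\<^sub>m ?M) *\<^sub>v (Y *\<^sub>v v) = c \<cdot>\<^sub>v (?M *\<^sub>v (Y *\<^sub>v v))"
    by (rule smult_mat_vec[OF M4 Yv])
  also have "?M *\<^sub>v (Y *\<^sub>v v) = Km p *\<^sub>v (adj W *\<^sub>v (Cmat p \<beta> k *\<^sub>v (W *\<^sub>v x)))"
    by (simp only: assoc_mult_mat_vec[OF M3 aK Yv] x_def[symmetric] assoc_mult_mat_vec[OF M2 W x]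
        assoc_mult_mat_vec[OF M1 Cmat_carrier Wx] assoc_mult_mat_vec[OF Km_carrier aW CWx])
  also have "ip (Y *\<^sub>v v) (c \<cdot>\<^sub>v \<dots>) = c * ip (Y *\<^sub>v v) \<dots>"
    using Yv by (intro ip_smult_right) auto
  also have "ip (Y *\<^sub>v v) (Km p *\<^sub>v (adj W *\<^sub>v (Cmat p \<beta> k *\<^sub>v (W *\<^sub>v x))))
      = ip x (adj W *\<^sub>v (Cmat p \<beta> k *\<^sub>v (W *\<^sub>v x)))"
    unfolding x_def using Yv W by (intro ip_adj'[OF Km_carrier]) auto
  also have "\<dots> = ip (W *\<^sub>v x) (Cmat p \<beta> k *\<^sub>v (W *\<^sub>v x))"
    by (rule ip_adj[OF W x CWx, symmetric])
  also have "\<dots> = of_real (cform k (W *\<^sub>v x))"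
    by (rule ip_Cmat_real[OF Wx])
  finally show ?thesis
    unfolding hform_def c_def x_def W_def Y_def weyl_vec_def vstack_one_mult_vec[OF \<Phi> v] by simp
qed

text \<open>Reduces the matrix condition to scalar series with nonnegative terms, where bounded
  partial sums and comparison apply.\<close>

lemma weyl_cond_iff:
  assumes "\<And>z. z \<in> upper_hp \<Longrightarrow> \<phi> z \<in> carrier_mat p p"
  shows "weyl_cond p \<beta> \<phi> \<longleftrightarrow>
    (\<forall>z\<in>upper_hp. \<forall>v\<in>carrier_vec p. summable (\<lambda>k. hform z k (weyl_vec (\<phi> z) v)))"
  unfolding weyl_cond_def
proof (intro ball_cong refl)
  fix z assume z: "z \<in> upper_hp"
  show "(\<forall>a<p. \<forall>b<p. summable (\<lambda>k. weyl_term p \<beta> \<phi> z k $$ (a, b))) \<longleftrightarrow>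
    (\<forall>v\<in>carrier_vec p. summable (\<lambda>k. hform z k (weyl_vec (\<phi> z) v)))"
    using summable_entries_iff_ip[of "weyl_term p \<beta> \<phi> z" p]
    by (simp add: weyl_term_carrier assms z ip_weyl_term summable_complex_of_real)
qed

lemma cform_parallelogram:
  assumes "x \<in> carrier_vec (p + p)" "y \<in> carrier_vec (p + p)"
  shows "cform k (x - y) + cform k (x + y) = 2 * cform k x + 2 * cform k y"
  using assms
  by (simp add: cform_def ip_linear[where n = "p + p"] mult_add_distrib_mat_vec[OF Cmat_carrier]
      mult_minus_distrib_mat_vec[OF Cmat_carrier])

lemma summable_hform_diff:
  assumes x: "x \<in> carrier_vec (p + p)" and y: "y \<in> carrier_vec (p + p)"
    and "summable (\<lambda>k. hform z k x)" "summable (\<lambda>k. hform z k y)"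
  shows "summable (\<lambda>k. hform z k (x - y))"
proof (rule summable_comparison_test)
  have "hform z k (x - y) + hform z k (x + y) = 2 * hform z k x + 2 * hform z k y" for k
  proof -
    let ?W = "\<lambda>x. Wsol p \<beta> k z *\<^sub>v x"
    have "hform z k (x - y) + hform z k (x + y) = qfun z ^ k * (cform k (?W x - ?W y) + cform k (?W x + ?W y))"
      unfolding hform_def mult_minus_distrib_mat_vec[OF Wsol_carrier x y]
        mult_add_distrib_mat_vec[OF Wsol_carrier x y] by (simp only: distrib_left)
    also have "cform k (?W x - ?W y) + cform k (?W x + ?W y) = 2 * cform k (?W x) + 2 * cform k (?W y)"
      by (rule cform_parallelogram) auto
    finally show ?thesis by (simp add: hform_def algebra_simps)
  qed
  then have "norm (hform z k (x - y)) \<le> 2 * hform z k x + 2 * hform z k y" for k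
    using hform_nonneg[of z k "x + y"] hform_nonneg[of z k "x - y"] by (smt (verit) real_norm_def)
  then show "\<exists>N. \<forall>k\<ge>N. norm (hform z k (x - y)) \<le> 2 * hform z k x + 2 * hform z k y" by blast
  show "summable (\<lambda>k. 2 * hform z k x + 2 * hform z k y)"
    using assms by (intro summable_add summable_mult)
qed

lemma summable_weyl_vec_unique:
  assumes A: "A \<in> carrier_mat p p" and B: "B \<in> carrier_mat p p" and z: "Im z > 0"
    and SA: "\<And>v. v \<in> carrier_vec p \<Longrightarrow> summable (\<lambda>k. hform z k (weyl_vec A v))"
    and SB: "\<And>v. v \<in> carrier_vec p \<Longrightarrow> summable (\<lambda>k. hform z k (weyl_vec B v))"
  shows "A = B"
proof -
  have dims: "dim_row A = p" "dim_row B = p" using A B by auto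
  have eq: "A *\<^sub>v v = B *\<^sub>v v" if v: "v \<in> carrier_vec p" for v
  proof -
    \<comment> \<open>The Weyl vectors of A and B at the same v differ by K^* [u; 0].\<close>
    define u where "u = (- \<i>) \<cdot>\<^sub>v (A *\<^sub>v v - B *\<^sub>v v)"
    have u: "u \<in> carrier_vec p" using dims by (simp add: u_def)
    define r where "r = Re (ip (\<i> \<cdot>\<^sub>v (A *\<^sub>v u)) u)"
    \<comment> \<open>\<open>K\<^sup>* [u; 0]\<close> is a neutral vector of a space on which the form is nonnegative, so it has to be
      orthogonal to that space; it is tested against the Weyl vector of \<open>u\<close>.\<close>
    have "nsq u \<le> - t * r" if t: "t > 0" for t
    proof -
      \<comment> \<open>Subtract the Weyl vector of B at v from that of A at v - t u: the upper
        component is -i (A v - B v) + t i A u, the lower one -t u. The real part of their pairing is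
        -t |u|^2 - t^2 r, and t > 0 can be divided out.\<close>
      let ?v = "v - complex_of_real t \<cdot>\<^sub>v u"
      let ?a = "u + complex_of_real t \<cdot>\<^sub>v (\<i> \<cdot>\<^sub>v (A *\<^sub>v u))" and ?b = "(- complex_of_real t) \<cdot>\<^sub>v u"
      have "weyl_vec A ?v - weyl_vec B v
          = adj (Km p) *\<^sub>v (((- \<i>) \<cdot>\<^sub>v (A *\<^sub>v ?v) @\<^sub>v ?v) - ((- \<i>) \<cdot>\<^sub>v (B *\<^sub>v v) @\<^sub>v v))"
        unfolding weyl_vec_def using dims u v
        by (intro mult_minus_distrib_mat_vec[OF adj_carrier[OF Km_carrier], symmetric]) auto
      also have "((- \<i>) \<cdot>\<^sub>v (A *\<^sub>v ?v) @\<^sub>v ?v) - ((- \<i>) \<cdot>\<^sub>v (B *\<^sub>v v) @\<^sub>v v) = ?a @\<^sub>v ?b"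
        unfolding mult_minus_distrib_mat_vec[OF A v iffD2[OF smult_carrier_vec u]] mult_mat_vec[OF A u]
        by (rule eq_vecI) (use dims u v in \<open>auto simp: u_def algebra_simps\<close>)
      finally have "weyl_vec A ?v - weyl_vec B v = adj (Km p) *\<^sub>v (?a @\<^sub>v ?b)" .
      moreover have "0 \<le> jform p (weyl_vec A ?v - weyl_vec B v)"
        using u v by (intro jform_nonneg_if_summable[OF _ z] summable_hform_diff SA SB) auto
      moreover have "jform p (adj (Km p) *\<^sub>v (?a @\<^sub>v ?b)) = 2 * Re (ip ?a ?b)"
        using u dims by (intro jform_adj_Km) auto
      moreover have "Re (ip ?a ?b) = t * (- nsq u - t * r)"
        unfolding r_def using u dims by (simp add: ip_linear[where n = p] algebra_simps)
      ultimately show ?thesis using t by (simp add: zero_le_mult_iff)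
    qed
    \<comment> \<open>As r does not depend on t, letting t decrease to 0 leaves
      \<open>nsq u \<le> 0\<close>.\<close>
    moreover have "((\<lambda>t. - t * r) \<longlongrightarrow> - 0 * r) (at_right 0)"
      by (intro tendsto_intros)
    ultimately have "nsq u \<le> - 0 * r"
      by (intro tendsto_lowerbound[of _ _ "at_right 0"]) (auto elim: eventually_mono[OF eventually_at_right_less])
    then have "nsq u = 0" using nsq_nonneg[of u] by simp
    then have u0: "u = 0\<^sub>v p" using nsq_eq_0_imp[of u] u by simp
    show ?thesis
    proof (rule eq_vecI)
      fix i assume "i < dim_vec (B *\<^sub>v v)"
      then have "i < p" using dims by simp
      then have "u $ i = 0" using u0 by simp
      then show "(A *\<^sub>v v) $ i = (B *\<^sub>v v) $ i" using \<open>i < p\<close> dims by (simp add: u_def)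
    qed (simp add: dims)
  qed
  show ?thesis
    using A B by (intro eq_matI) (auto simp: index_eq_ip[OF A] index_eq_ip[OF B] eq)
qed

end

section \<open>Block matrices, isolated singularities and limits of vectors\<close>

lemma four_block_blk:
  assumes "M \<in> carrier_mat (p + p) (p + p)"
  shows "four_block_mat (blk p M 0 0) (blk p M 0 1) (blk p M 1 0) (blk p M 1 1) = M"
  using assms by (intro eq_matI) (auto simp: blk_def not_less)

lemma qform_eq_ip:
  assumes "M \<in> carrier_mat n n" "x \<in> carrier_vec n"
  shows "qform M (\<lambda>i. x $ i) = ip x (M *\<^sub>v x)"
  using assms
  by (auto simp: qform_def ip_def scalar_prod_def sum_distrib_left mult.assoc lessThan_atLeast0 intro!: sum.cong)

lemma ip_adj_mult_self:
  assumes A: "A \<in> carrier_mat n n" and x: "x \<in> carrier_vec n"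
  shows "ip x ((adj A * A) *\<^sub>v x) = ip (A *\<^sub>v x) (A *\<^sub>v x)"
proof -
  have "A *\<^sub>v x \<in> carrier_vec n" using A by simp
  then show ?thesis
    using assoc_mult_mat_vec[OF adj_carrier[OF A] A x] ip_adj[OF A x] by simp
qed

text \<open>Each meromorphic entry has an isolated singularity at worst, and there are finitely many
  entries.\<close>

lemma eventually_mat_regular_at:
  assumes "mat_meromorphic_on n R S" "z \<in> S"
  shows "\<forall>\<^sub>F w in at z. mat_regular_at n R w"
proof -
  have "\<forall>\<^sub>F w in at z. (\<lambda>w. R w $$ (a, b)) analytic_on {w}" if "a < n" "b < n" for a b
  proof -
    have "(\<lambda>w. R w $$ (a, b)) meromorphic_on S"
      using assms that by (simp add: mat_meromorphic_on_def)
    then have "isolated_singularity_at (\<lambda>w. R w $$ (a, b)) z"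
      using assms(2) by (simp add: meromorphic_on_altdef)
    then show ?thesis
      by (simp add: isolated_singularity_at_altdef)
  qed
  then have "\<forall>\<^sub>F w in at z. \<forall>a\<in>{..<n}. \<forall>b\<in>{..<n}. (\<lambda>w. R w $$ (a, b)) analytic_on {w}"
    by (intro eventually_ball_finite ballI) auto
  then show ?thesis by eventually_elim (auto simp: mat_regular_at_def)
qed

text \<open>Entrywise convergence. The length is imposed at every point and not just eventually, so
  dimensions can be rewritten unconditionally.\<close>

definition vtendsto :: "nat \<Rightarrow> ('a \<Rightarrow> complex Matrix.vec) \<Rightarrow> complex Matrix.vec \<Rightarrow> 'a filter \<Rightarrow> bool" where
  "vtendsto n f l F \<longleftrightarrow> (\<forall>w. f w \<in> carrier_vec n) \<and> l \<in> carrier_vec n \<and>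
     (\<forall>i<n. ((\<lambda>w. f w $ i) \<longlongrightarrow> l $ i) F)"

lemma vtendsto_const: "v \<in> carrier_vec n \<Longrightarrow> vtendsto n (\<lambda>_. v) v F"
  by (simp add: vtendsto_def)

lemma vtendsto_diff:
  assumes "vtendsto n f l F" "vtendsto n g m F"
  shows "vtendsto n (\<lambda>w. f w - g w) (l - m) F"
proof -
  have d: "dim_vec (g w) = n" "dim_vec m = n" for w using assms by (auto simp: vtendsto_def)
  show ?thesis using assms by (auto simp: vtendsto_def d intro: tendsto_diff)
qed

lemma vtendsto_smult:
  assumes "(c \<longlongrightarrow> c0) F" "vtendsto n f l F"
  shows "vtendsto n (\<lambda>w. c w \<cdot>\<^sub>v f w) (c0 \<cdot>\<^sub>v l) F"
proof -
  have d: "dim_vec (f w) = n" "dim_vec l = n" for w using assms by (auto simp: vtendsto_def)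
  show ?thesis using assms by (auto simp: vtendsto_def d intro: tendsto_mult)
qed

lemma vtendsto_append:
  assumes "vtendsto n f l F" "vtendsto m g k F"
  shows "vtendsto (n + m) (\<lambda>w. f w @\<^sub>v g w) (l @\<^sub>v k) F"
proof -
  have d: "dim_vec (f w) = n" "dim_vec l = n" "dim_vec (g w) = m" "dim_vec k = m" for w
    using assms by (auto simp: vtendsto_def)
  show ?thesis using assms by (auto simp: vtendsto_def d)
qed

lemma vtendsto_mult:
  assumes A: "\<And>w. A w \<in> carrier_mat n m" "A0 \<in> carrier_mat n m"
    and lim: "\<And>i j. i < n \<Longrightarrow> j < m \<Longrightarrow> ((\<lambda>w. A w $$ (i, j)) \<longlongrightarrow> A0 $$ (i, j)) F"
    and f: "vtendsto m f l F"
  shows "vtendsto n (\<lambda>w. A w *\<^sub>v f w) (A0 *\<^sub>v l) F"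
proof -
  have d: "dim_row (A w) = n" "dim_col (A w) = m" "dim_row A0 = n" "dim_col A0 = m"
    "dim_vec (f w) = m" "dim_vec l = m" for w
    using A(1)[of w] A(2) f by (auto simp: vtendsto_def)
  have "((\<lambda>w. (A w *\<^sub>v f w) $ i) \<longlongrightarrow> (A0 *\<^sub>v l) $ i) F" if "i < n" for i
    using that f by (auto simp: d scalar_prod_def vtendsto_def intro!: tendsto_sum tendsto_mult lim)
  then show ?thesis by (simp add: vtendsto_def d)
qed

lemma vtendsto_mult_const:
  "A \<in> carrier_mat n m \<Longrightarrow> vtendsto m f l F \<Longrightarrow> vtendsto n (\<lambda>w. A *\<^sub>v f w) (A *\<^sub>v l) F"
  by (rule vtendsto_mult) auto

lemma tendsto_ip:
  assumes "vtendsto n f l F" "vtendsto n g m F"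
  shows "((\<lambda>w. ip (f w) (g w)) \<longlongrightarrow> ip l m) F"
proof -
  have d: "dim_vec (g w) = n" "dim_vec m = n" for w using assms by (auto simp: vtendsto_def)
  show ?thesis
    using assms unfolding ip_def d by (auto simp: vtendsto_def intro!: tendsto_sum tendsto_mult tendsto_cnj)
qed

section \<open>Membership in N(N) makes the form of j nonnegative\<close>

context canonical_system
begin

text \<open>Induction along the recursion: all coefficients are constant except i / g, which
  converges because its limit point is nonzero.\<close>

lemma vtendsto_Wsol:
  assumes f: "vtendsto (p + p) f x F" and g: "(g \<longlongrightarrow> z) F" and z: "z \<noteq> 0"
  shows "vtendsto (p + p) (\<lambda>w. Wsol p \<beta> k (g w) *\<^sub>v f w) (Wsol p \<beta> k z *\<^sub>v x) F"
proof (induction k)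
  case 0
  have "f w \<in> carrier_vec (p + p)" "x \<in> carrier_vec (p + p)" for w
    using f by (auto simp: vtendsto_def)
  then show ?case using f by (simp add: mult_2[of p])
next
  case (Suc k)
  have "f w \<in> carrier_vec (p + p)" "x \<in> carrier_vec (p + p)" for w
    using f by (auto simp: vtendsto_def)
  then show ?case
    using z unfolding Wsol_Suc_mult_vec[OF \<open>f _ \<in> _\<close>] Wsol_Suc_mult_vec[OF \<open>x \<in> _\<close>] proj_def
    by (intro vtendsto_diff vtendsto_smult Suc vtendsto_mult_const[OF jm_carrier]
        vtendsto_mult_const[OF adj_carrier[OF \<gamma>_carrier]] vtendsto_mult_const[OF \<gamma>_carrier]
        tendsto_divide tendsto_const g) auto
qed

text \<open>The relation between \<open>\<Phi>\<close>, D and U says that W maps the range of [R; Q]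
  into the orthogonal complement of [-i \<Phi>^* v; v]. With W = K V^*, the factors move to the
  other side, so y is orthogonal to the range of [R; Q]. That range is maximal nonpositive for j,
  hence y has a nonnegative form.\<close>

lemma jform_nonneg_at_regular_point:
  fixes N z
  assumes \<Phi>: "\<Phi> \<in> carrier_mat p p" and R: "R \<in> carrier_mat p p" and Q: "Q \<in> carrier_mat p p"
    and v: "v \<in> carrier_vec p"
  defines "W \<equiv> calW p \<beta> N z"
  defines "D \<equiv> blk p W 0 0 * R + blk p W 0 1 * Q" and "U \<equiv> blk p W 1 0 * R + blk p W 1 1 * Q"
  assumes pos: "posdef (adj R * R + adj Q * Q)" and psd: "psd (adj Q * Q - adj R * R)"
    and eq: "\<Phi> * D = \<i> \<cdot>\<^sub>m U"
  shows "0 \<le> jform p (Wsol p \<beta> (Suc N) (cnj z) *\<^sub>v weyl_vec (adj \<Phi>) v)"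
proof -
  define V where "V = Wsol p \<beta> (Suc N) (cnj z)"
  have V: "V \<in> carrier_mat (p + p) (p + p)" unfolding V_def by (rule Wsol_carrier)
  have W_eq: "W = Km p * adj V" by (simp only: W_def calW_def V_def)
  have W: "W \<in> carrier_mat (p + p) (p + p)"
    unfolding W_eq by (rule mult_carrier_mat[OF Km_carrier adj_carrier[OF V]])
  have blk: "blk p W i j \<in> carrier_mat p p" for i j by (simp add: blk_def)
  have D: "D \<in> carrier_mat p p" and U: "U \<in> carrier_mat p p"
    unfolding D_def U_def by (auto intro!: add_carrier_mat mult_carrier_mat[OF blk] R Q)
  define w where "w = (- \<i>) \<cdot>\<^sub>v (adj \<Phi> *\<^sub>v v) @\<^sub>v v"
  have \<Phi>v: "adj \<Phi> *\<^sub>v v \<in> carrier_vec p" using \<Phi> by simp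
  have w: "w \<in> carrier_vec (p + p)" using v \<Phi>v by (simp add: w_def)
  define y where "y = V *\<^sub>v (adj (Km p) *\<^sub>v w)"
  have y: "y \<in> carrier_vec (p + p)" using V by (simp add: y_def)
  obtain y1 y2 where yy: "y1 \<in> carrier_vec p" "y2 \<in> carrier_vec p" "y = y1 @\<^sub>v y2"
    using y by (rule split_vec)
  have dims: "dim_col R = p" "dim_col Q = p" using R Q by auto
  have RQ: "nsq (R *\<^sub>v x) \<le> nsq (Q *\<^sub>v x)" if x: "x \<in> carrier_vec p" for x
  proof -
    have c: "adj Q * Q \<in> carrier_mat p p" "adj R * R \<in> carrier_mat p p"
      using R Q by (auto intro!: mult_carrier_mat)
    then have "qform (adj Q * Q - adj R * R) (\<lambda>i. x $ i)
        = ip (Q *\<^sub>v x) (Q *\<^sub>v x) - ip (R *\<^sub>v x) (R *\<^sub>v x)"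
      using x dims by (simp add: qform_eq_ip[of _ p] minus_mult_distrib_mat_vec[OF c x] ip_diff_right[of _ p]
          ip_adj_mult_self[OF Q] ip_adj_mult_self[OF R] minus_carrier_mat del: assoc_mult_mat_vec)
    then show ?thesis using psd by (auto simp: psd_def dest!: spec[of _ "\<lambda>i. x $ i"])
  qed
  \<comment> \<open>Here Q is the dominating block, so the complement lemma is used with the two
    components interchanged.\<close>
  have "nsq y2 \<le> nsq y1"
  proof (rule orthogonal_complement_semidefinite[OF Q R yy(2,1) RQ])
    fix x :: "complex Matrix.vec" assume x: "x \<in> carrier_vec p"
    have Rx: "R *\<^sub>v x \<in> carrier_vec p" and Qx: "Q *\<^sub>v x \<in> carrier_vec p" and Dx: "D *\<^sub>v x \<in> carrier_vec p"
      and Ux: "U *\<^sub>v x \<in> carrier_vec p"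
      using R Q D U by auto
    let ?s = "R *\<^sub>v x @\<^sub>v Q *\<^sub>v x"
    have s: "?s \<in> carrier_vec (p + p)" using Rx Qx by simp
    have "W *\<^sub>v ?s = (blk p W 0 0 *\<^sub>v (R *\<^sub>v x) + blk p W 0 1 *\<^sub>v (Q *\<^sub>v x)) @\<^sub>v
        (blk p W 1 0 *\<^sub>v (R *\<^sub>v x) + blk p W 1 1 *\<^sub>v (Q *\<^sub>v x))"
      using four_block_mat_mult_vec[OF blk blk blk blk Rx Qx, of 0 0 0 1 1 0 1 1]
      unfolding four_block_blk[OF W] .
    also have "\<dots> = D *\<^sub>v x @\<^sub>v U *\<^sub>v x"
      unfolding D_def U_def
      by (simp only: add_mult_distrib_mat_vec[OF mult_carrier_mat[OF blk R] mult_carrier_mat[OF blk Q] x]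
          assoc_mult_mat_vec[OF blk R x] assoc_mult_mat_vec[OF blk Q x])
    finally have Ws: "W *\<^sub>v ?s = D *\<^sub>v x @\<^sub>v U *\<^sub>v x" .
    have "\<i> \<cdot>\<^sub>v (U *\<^sub>v x) = \<Phi> *\<^sub>v (D *\<^sub>v x)"
      by (simp only: smult_mat_vec[OF U x, symmetric] eq[symmetric] assoc_mult_mat_vec[OF \<Phi> D x])
    \<comment> \<open>The first slot is conjugate-linear, so the factor i in front of U becomes -i;
      solving for the pairing with U x gives the term that cancels the -i in the upper half of
      w.\<close>
    then have "cnj \<i> * ip (U *\<^sub>v x) v = ip (D *\<^sub>v x) (adj \<Phi> *\<^sub>v v)"
      using ip_smult_left[OF Ux v, of \<i>] ip_adj[OF \<Phi> Dx v] by simp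
    then have "ip (U *\<^sub>v x) v = \<i> * ip (D *\<^sub>v x) (adj \<Phi> *\<^sub>v v)"
      by (metis (no_types, opaque_lifting) complex_cnj_i complex_i_mult_minus minus_mult_left mult_minus_right minus_minus)
    moreover have "ip (D *\<^sub>v x) ((- \<i>) \<cdot>\<^sub>v (adj \<Phi> *\<^sub>v v)) = - \<i> * ip (D *\<^sub>v x) (adj \<Phi> *\<^sub>v v)"
      by (rule ip_smult_right[OF Dx \<Phi>v])
    ultimately have 0: "ip (W *\<^sub>v ?s) w = 0"
      unfolding Ws w_def using Dx Ux v \<Phi>v by (subst ip_append) auto
    have "ip ?s y = ip (adj V *\<^sub>v ?s) (adj (Km p) *\<^sub>v w)"
      unfolding y_def by (rule ip_adj'[OF V s]) simp
    also have "\<dots> = ip (Km p *\<^sub>v (adj V *\<^sub>v ?s)) w"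
      using V w by (intro ip_adj[OF Km_carrier, symmetric]) auto
    also have "Km p *\<^sub>v (adj V *\<^sub>v ?s) = W *\<^sub>v ?s"
      unfolding W_eq by (rule assoc_mult_mat_vec[OF Km_carrier adj_carrier[OF V] s, symmetric])
    finally show "ip (Q *\<^sub>v x) y2 + ip (R *\<^sub>v x) y1 = 0"
      unfolding yy(3) 0 using Rx Qx yy by (simp add: ip_append add.commute)
    \<comment> \<open>Domination forces R x = 0 as well, and then definiteness of R^* R + Q^* Q
      forces x = 0.\<close>
    assume "Q *\<^sub>v x = 0\<^sub>v p"
    then have Q0: "nsq (Q *\<^sub>v x) = 0" by (simp add: ip_def)
    then have R0: "nsq (R *\<^sub>v x) = 0" using RQ[OF x] nsq_nonneg[of "R *\<^sub>v x"] by simp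
    have c: "adj Q * Q \<in> carrier_mat p p" "adj R * R \<in> carrier_mat p p"
      using R Q by (auto intro!: mult_carrier_mat)
    then have "qform (adj R * R + adj Q * Q) (\<lambda>i. x $ i)
        = ip (R *\<^sub>v x) (R *\<^sub>v x) + ip (Q *\<^sub>v x) (Q *\<^sub>v x)"
      using x dims by (simp add: qform_eq_ip[of _ p] add_mult_distrib_mat_vec[OF c(2,1) x] ip_add_right[of _ p]
          ip_adj_mult_self[OF Q] ip_adj_mult_self[OF R] del: assoc_mult_mat_vec)
    then have "Re (qform (adj R * R + adj Q * Q) (\<lambda>i. x $ i)) = 0"
      using Q0 R0 by simp
    moreover have "dim_row (adj R * R + adj Q * Q) = p" using c by auto
    ultimately have "\<forall>i<p. x $ i = 0"
      using pos unfolding posdef_def by (metis less_irrefl)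
    then show "x = 0\<^sub>v p" using x by auto
  qed
  then show ?thesis
    using yy unfolding weyl_vec_def V_def[symmetric] w_def[symmetric] y_def[symmetric]
    by (simp add: jip_append)
qed

text \<open>Near any point of the lower half-plane, apart from the point itself, the pair (R, Q) is
  regular and the inequality holds; it passes to the point in the limit.\<close>

lemma jform_nonneg_NN:
  assumes \<phi>: "\<phi> \<in> NN p \<beta> N" and z: "Im z > 0" and v: "v \<in> carrier_vec p"
  shows "0 \<le> jform p (Wsol p \<beta> (Suc N) z *\<^sub>v weyl_vec (adj (\<phi> (cnj z))) v)"
proof -
  \<comment> \<open>\<open>calW\<close> at \<open>\<zeta>\<close> is built from \<open>Wsol\<close>
    at \<open>cnj \<zeta>\<close>, which is z.\<close>
  define \<zeta> where "\<zeta> = cnj z"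
  have \<zeta>: "\<zeta> \<in> lower_hp" using z by (simp add: \<zeta>_def lower_hp_def)
  have op: "open lower_hp" unfolding lower_hp_def by (rule open_halfspace_Im_lt)
  obtain R Q where hol: "mat_holomorphic_on p \<phi> lower_hp"
    and mero: "mat_meromorphic_on p R lower_hp" "mat_meromorphic_on p Q lower_hp"
    and repr: "\<And>w. w \<in> lower_hp \<Longrightarrow> mat_regular_at p R w \<Longrightarrow> mat_regular_at p Q w \<Longrightarrow>
           (let W = calW p \<beta> N w;
                D = blk p W 0 0 * R w + blk p W 0 1 * Q w;
                U = blk p W 1 0 * R w + blk p W 1 1 * Q w
            in posdef (adj (R w) * R w + adj (Q w) * Q w) \<and>
               psd (adj (Q w) * Q w - adj (R w) * R w) \<and>
               invertible_mat D \<and> \<phi> w * D = \<i> \<cdot>\<^sub>m U)"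
    using \<phi> unfolding NN_def by blast
  have \<phi>_carrier: "\<phi> w \<in> carrier_mat p p" if "w \<in> lower_hp" for w
    using hol that by (auto simp: mat_holomorphic_on_def)
  have RQ_carrier: "R w \<in> carrier_mat p p" "Q w \<in> carrier_mat p p" for w
    using mero by (auto simp: mat_meromorphic_on_def)
  \<comment> \<open>\<open>\<phi>\<close> may have other dimensions outside the half-plane; \<open>\<Phi>\<close> has the right ones everywhere.\<close>
  define \<Phi> where "\<Phi> w = mat p p (\<lambda>ij. \<phi> w $$ ij)" for w
  have \<Phi>_eq: "\<Phi> w = \<phi> w" if "w \<in> lower_hp" for w
    using \<phi>_carrier[OF that] by (auto simp: \<Phi>_def)
  define x where "x w = Wsol p \<beta> (Suc N) (cnj w) *\<^sub>v weyl_vec (adj (\<Phi> w)) v" for w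
  have "\<forall>\<^sub>F w in at \<zeta>. w \<in> lower_hp"
    using op \<zeta> by (rule eventually_at_in_open')
  then have "\<forall>\<^sub>F w in at \<zeta>. 0 \<le> jform p (x w)"
    using eventually_mat_regular_at[OF mero(1) \<zeta>] eventually_mat_regular_at[OF mero(2) \<zeta>]
  proof eventually_elim
    case (elim w)
    show ?case
      unfolding x_def \<Phi>_eq[OF elim(1)]
      using repr[OF elim]
      by (intro jform_nonneg_at_regular_point[OF \<phi>_carrier[OF elim(1)] RQ_carrier[of w] v]) (auto simp: Let_def)
  qed
  \<comment> \<open>The vector depends on w through conjugates and adjoints, so continuity is used
    rather than holomorphy.\<close>
  moreover have "((\<lambda>w. jform p (x w)) \<longlongrightarrow> jform p (x \<zeta>)) (at \<zeta>)"
  proof -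
    have "((\<lambda>w. \<phi> w $$ (a, b)) \<longlongrightarrow> \<phi> \<zeta> $$ (a, b)) (at \<zeta>)" if "a < p" "b < p" for a b
    proof -
      have "continuous_on lower_hp (\<lambda>w. \<phi> w $$ (a, b))"
        using hol that by (auto simp: mat_holomorphic_on_def intro: holomorphic_on_imp_continuous_on)
      then show ?thesis using op \<zeta> by (simp add: continuous_on_eq_continuous_at isCont_def)
    qed
    then have adj_lim: "((\<lambda>w. adj (\<Phi> w) $$ (a, b)) \<longlongrightarrow> adj (\<Phi> \<zeta>) $$ (a, b)) (at \<zeta>)"
      if "a < p" "b < p" for a b
      using that by (simp add: adj_def \<Phi>_def tendsto_cnj)
    have adj_carrier': "adj (\<Phi> w) \<in> carrier_mat p p" for w by (simp add: \<Phi>_def)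
    have "vtendsto (p + p) (\<lambda>w. weyl_vec (adj (\<Phi> w)) v) (weyl_vec (adj (\<Phi> \<zeta>)) v) (at \<zeta>)"
      unfolding weyl_vec_def
      by (intro vtendsto_mult_const[of _ _ "p + p"] vtendsto_append vtendsto_smult vtendsto_mult[where m = p] vtendsto_const
          v tendsto_const adj_carrier' adj_lim) auto
    then have "vtendsto (p + p) x (x \<zeta>) (at \<zeta>)"
      unfolding x_def
      by (rule vtendsto_Wsol) (use \<zeta> in \<open>auto intro!: tendsto_intros simp: lower_hp_def\<close>)
    then show ?thesis
      unfolding jip_def by (intro tendsto_Re tendsto_ip[where n = "p + p"] vtendsto_mult_const[OF jm_carrier])
  qed
  ultimately have "0 \<le> jform p (x \<zeta>)"
    by (intro tendsto_lowerbound[of _ _ "at \<zeta>"]) auto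
  then show ?thesis unfolding x_def \<Phi>_eq[OF \<zeta>] by (simp add: \<zeta>_def del: Wsol.simps)
qed

end

section \<open>Reflection to the upper half-plane, existence and uniqueness\<close>

theorem theorem6p8:
  fixes p :: nat and \<beta> :: "nat \<Rightarrow> complex mat" and \<phi>inf :: "complex \<Rightarrow> complex mat"
  assumes "p \<ge> 1"
    and "\<And>k. \<beta> k \<in> carrier_mat p (2*p)"
    and "\<And>k. \<beta> k * Jm p * adj (\<beta> k) = 1\<^sub>m p"
    and "\<forall>N. \<phi>inf \<in> NN p \<beta> N"
  shows "mat_holomorphic_on p (\<lambda>z. adj (\<phi>inf (cnj z))) upper_hp
       \<and> weyl_cond p \<beta> (\<lambda>z. adj (\<phi>inf (cnj z)))
       \<and> (\<forall>\<phi>. mat_holomorphic_on p \<phi> upper_hp \<and> weyl_cond p \<beta> \<phi>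
              \<longrightarrow> (\<forall>z\<in>upper_hp. \<phi> z = adj (\<phi>inf (cnj z))))"
proof -
  \<comment> \<open>The locale writes the size as \<open>p + p\<close> so that it agrees literally
    with appended vectors and block matrices.\<close>
  interpret canonical_system p \<beta>
    using assms(2,3) by unfold_locales (auto simp: mult_2)
  let ?\<psi> = "\<lambda>z. adj (\<phi>inf (cnj z))"
  have hol: "mat_holomorphic_on p \<phi>inf lower_hp"
    using assms(4) by (auto simp: NN_def)
  have cnj_upper: "cnj z \<in> lower_hp" if "z \<in> upper_hp" for z
    using that by (simp add: lower_hp_def upper_hp_def)
  have \<phi>inf_carrier: "\<phi>inf (cnj z) \<in> carrier_mat p p" if "z \<in> upper_hp" for z
    using hol cnj_upper[OF that] by (auto simp: mat_holomorphic_on_def)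
  have \<psi>_carrier: "?\<psi> z \<in> carrier_mat p p" if "z \<in> upper_hp" for z
    using \<phi>inf_carrier[OF that] by simp
  have "mat_holomorphic_on p ?\<psi> upper_hp"
    unfolding mat_holomorphic_on_def
  proof (intro conjI ballI allI impI)
    fix a b assume ab: "a < p" "b < p"
    have "cnj ` upper_hp = lower_hp"
      by (auto simp: lower_hp_def upper_hp_def intro!: image_eqI[of _ cnj "cnj _"])
    moreover have "open upper_hp" unfolding upper_hp_def by (rule open_halfspace_Im_gt)
    moreover have "(\<lambda>z. \<phi>inf z $$ (b, a)) holomorphic_on lower_hp"
      using hol ab by (simp add: mat_holomorphic_on_def)
    \<comment> \<open>Conjugating both argument and value preserves holomorphy; the adjoint also
      transposes, hence the entry (b, a).\<close>
    ultimately have "cnj \<circ> (\<lambda>z. \<phi>inf z $$ (b, a)) \<circ> cnj holomorphic_on upper_hp"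
      by (intro holomorphic_on_compose_cnj_cnj) auto
    then show "(\<lambda>z. ?\<psi> z $$ (a, b)) holomorphic_on upper_hp"
    proof (rule holomorphic_transform)
      fix z assume "z \<in> upper_hp"
      then have "dim_row (\<phi>inf (cnj z)) = p" "dim_col (\<phi>inf (cnj z)) = p"
        using \<phi>inf_carrier by blast+
      then show "(cnj \<circ> (\<lambda>z. \<phi>inf z $$ (b, a)) \<circ> cnj) z = ?\<psi> z $$ (a, b)"
        using ab by (simp add: adj_def)
    qed
  qed (simp_all add: carrier_matD[OF \<phi>inf_carrier])
  \<comment> \<open>Membership for every N gives a nonnegative form at every index from 1 on, which
    bounds all partial sums.\<close>
  moreover have sum_\<psi>: "summable (\<lambda>k. hform z k (weyl_vec (?\<psi> z) v))"
    if "z \<in> upper_hp" "v \<in> carrier_vec p" for z v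
    using that assms(4)
    by (intro summable_if_jform_nonneg jform_nonneg_NN) (auto simp: upper_hp_def)
  then have "weyl_cond p \<beta> ?\<psi>"
    using weyl_cond_iff[of ?\<psi>, OF \<psi>_carrier] by blast
  moreover have "\<phi> z = ?\<psi> z"
    if "mat_holomorphic_on p \<phi> upper_hp" and W: "weyl_cond p \<beta> \<phi>" and z: "z \<in> upper_hp" for \<phi> z
  proof -
    have \<phi>: "\<phi> z \<in> carrier_mat p p" if "z \<in> upper_hp" for z
      using \<open>mat_holomorphic_on p \<phi> upper_hp\<close> that by (auto simp: mat_holomorphic_on_def)
    \<comment> \<open>The two functions are compared at each z separately, through their Weyl
      vectors.\<close>
    show ?thesis
    proof (rule summable_weyl_vec_unique[OF \<phi>[OF z] \<psi>_carrier[OF z]])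
      show "Im z > 0" using z by (simp add: upper_hp_def)
      show "summable (\<lambda>k. hform z k (weyl_vec (\<phi> z) v))" if "v \<in> carrier_vec p" for v
        using W z that by (simp add: weyl_cond_iff[OF \<phi>])
      show "summable (\<lambda>k. hform z k (weyl_vec (?\<psi> z) v))" if "v \<in> carrier_vec p" for v
        using z that by (rule sum_\<psi>)
    qed
  qed
  ultimately show ?thesis by blast
qed

end
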